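(* Let $G$ be a Polish group. If $G$ admits a coarse Cayley--Abels--Rosendal graph, then $G$ is locally bounded; moreover, for any such graph $\Gamma$, the orbit map $G\to V(\Gamma)$, where $V(\Gamma)$ carries the metric induced from $\Gamma$, is a coarse equivalence. If $G$ is non-Archimedean, then the converse holds: if $G$ is locally bounded, then $G$ admits a coarse Cayley--Abels--Rosendal graph.
   Context: **Coarse geometry.** A pseudometric $d$ on $X$ induces the coarse structure $\mathcal{E}_d$ of all $E\subseteq X\times X$ with $E\subseteq\{(x,y):d(x,y)<\alpha\}$ for some $\alpha<\infty$. A topological group $G$ carries the left-coarse structure $\mathcal{E}_L=\bigcap\{\mathcal{E}_d: d$ a continuous left-invariant pseudometric on $G\}$; metric spaces carry $\mathcal{E}_d$. $A\subseteq G$ is coarsely bounded if $A\times A\in\mathcal{E}_L$. $G$ is locally bounded if it has a coarsely bounded neighborhood of the identity. A map $\varphi:(X,\mathcal{E})\to(Y,\mathcal{F})$ is bornologous if $(\varphi\times\varphi)(E)\in\mathcal{F}$ for all $E\in\mathcal{E}$; it is a coarse equivalence if it is bornologous and there is a bornologous $\psi:Y\to X$ with $\psi\circ\varphi$ close to $\mathrm{Id}_X$ and $\varphi\circ\psi$ close to $\mathrm{Id}_Y$ (maps $\alpha,\beta:Z\to X$ are close if for some $E\in\mathcal{E}$, $(\alpha(z),\beta(z))\in E$ for all $z$). A Polish group is non-Archimedean if it has a neighborhood basis at the identity consisting of (clopen) subgroups. **Coarse Cayley--Abels--Rosendal graphs.** A metric graph is a graph with positive edge lengths, endowed with the path metric.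 An action of a group $G$ on a metric graph $\Gamma$ is bounded-cocompact if for every closed bounded subgraph $\Lambda\subset\Gamma$, $G\Lambda/G$ is compact. A coarse Cayley--Abels--Rosendal graph for a topological group $G$ is a connected metric graph $\Gamma$ with discrete vertex set $V(\Gamma)$, along with a continuous action of $G$ by isometries that are graph isomorphisms, such that the action is vertex-transitive and bounded-cocompact with coarsely bounded vertex stabilizers. The orbit map is $g\mapsto gx$ for a fixed vertex $x$. *)

theory Defs
  imports "HOL-Analysis.Analysis"
begin

text \<open>Groups are types of class \<open>topological_group_add\<close>. The class \<open>group_add\<close> does not assume
  commutativity, so additive notation is used here for arbitrary groups: \<open>0\<close> is the identity, \<open>g + h\<close>
  the product and \<open>- g\<close> the inverse. A Polish group is a type that is in addition of class
  \<open>polish_space\<close>; the metric that this class carries is only required to be complete and to induce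
  the topology, and it is not used in any definition below.\<close>


section \<open>Coarse geometry\<close>

definition pseudometric :: "('a \<Rightarrow> 'a \<Rightarrow> real) \<Rightarrow> bool" where
  "pseudometric d \<longleftrightarrow>
     (\<forall>x. d x x = 0) \<and> (\<forall>x y. 0 \<le> d x y) \<and> (\<forall>x y. d x y = d y x) \<and>
     (\<forall>x y z. d x z \<le> d x y + d y z)"

definition metric_coarse :: "'a set \<Rightarrow> ('a \<Rightarrow> 'a \<Rightarrow> real) \<Rightarrow> ('a \<times> 'a) set set" where
  "metric_coarse X d = {E. E \<subseteq> X \<times> X \<and> (\<exists>\<alpha>::real. \<forall>(x, y)\<in>E. d x y < \<alpha>)}"

definition cont_left_invariant_pseudometric ::
    "('g::topological_group_add \<Rightarrow> 'g \<Rightarrow> real) \<Rightarrow> bool" where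
  "cont_left_invariant_pseudometric d \<longleftrightarrow>
     pseudometric d \<and> continuous_on UNIV (\<lambda>(x, y). d x y) \<and>
     (\<forall>g x y. d (g + x) (g + y) = d x y)"

definition left_coarse :: "('g::topological_group_add \<times> 'g) set set" where
  "left_coarse = (\<Inter>d \<in> Collect cont_left_invariant_pseudometric. metric_coarse UNIV d)"

definition coarsely_bounded :: "'g::topological_group_add set \<Rightarrow> bool" where
  "coarsely_bounded A \<longleftrightarrow> A \<times> A \<in> left_coarse"

definition locally_bounded :: "'g::topological_group_add itself \<Rightarrow> bool" where
  "locally_bounded (_ :: 'g itself) \<longleftrightarrow> (\<exists>U::'g set. 0 \<in> interior U \<and> coarsely_bounded U)"

definition bornologous ::
    "'a set \<Rightarrow> ('a \<times> 'a) set set \<Rightarrow> 'b set \<Rightarrow> ('b \<times> 'b) set set \<Rightarrow> ('a \<Rightarrow> 'b) \<Rightarrow> bool" where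
  "bornologous X \<E> Y \<F> \<phi> \<longleftrightarrow> \<phi> \<in> X \<rightarrow> Y \<and> (\<forall>E\<in>\<E>. map_prod \<phi> \<phi> ` E \<in> \<F>)"

definition close_maps :: "'z set \<Rightarrow> ('a \<times> 'a) set set \<Rightarrow> ('z \<Rightarrow> 'a) \<Rightarrow> ('z \<Rightarrow> 'a) \<Rightarrow> bool" where
  "close_maps Z \<E> f g \<longleftrightarrow> (\<exists>E\<in>\<E>. \<forall>z\<in>Z. (f z, g z) \<in> E)"

definition coarse_equivalence ::
    "'a set \<Rightarrow> ('a \<times> 'a) set set \<Rightarrow> 'b set \<Rightarrow> ('b \<times> 'b) set set \<Rightarrow> ('a \<Rightarrow> 'b) \<Rightarrow> bool" where
  "coarse_equivalence X \<E> Y \<F> \<phi> \<longleftrightarrow>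
     bornologous X \<E> Y \<F> \<phi> \<and>
     (\<exists>\<psi>. bornologous Y \<F> X \<E> \<psi> \<and>
          close_maps X \<E> (\<psi> \<circ> \<phi>) id \<and> close_maps Y \<F> (\<phi> \<circ> \<psi>) id)"

definition is_subgroup :: "'g::group_add set \<Rightarrow> bool" where
  "is_subgroup H \<longleftrightarrow> 0 \<in> H \<and> (\<forall>x\<in>H. \<forall>y\<in>H. x + y \<in> H) \<and> (\<forall>x\<in>H. - x \<in> H)"

definition non_archimedean :: "'g::topological_group_add itself \<Rightarrow> bool" where
  "non_archimedean (_ :: 'g itself) \<longleftrightarrow>
     (\<forall>U::'g set. open U \<and> 0 \<in> U \<longrightarrow> (\<exists>H. is_subgroup H \<and> open H \<and> closed H \<and> H \<subseteq> U))"


section \<open>Metric graphs\<close>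

text \<open>Graphs may have loops and multiple edges. The orientation of an edge from \<open>src\<close> to \<open>tgt\<close> only
  serves to parametrise the edge by \<open>[0, len e]\<close>; graph isomorphisms need not preserve it.\<close>

record ('v, 'e) metric_graph =
  verts :: "'v set"
  edges :: "'e set"
  src :: "'e \<Rightarrow> 'v"
  tgt :: "'e \<Rightarrow> 'v"
  len :: "'e \<Rightarrow> real"

text \<open>Points of the geometric realization: \<open>Inner e t\<close> is the point of the open edge \<open>e\<close> at parameter
  \<open>t \<in> (0, len e)\<close>.\<close>

datatype ('v, 'e) point = Vertex 'v | Inner 'e real

definition points :: "('v, 'e) metric_graph \<Rightarrow> ('v, 'e) point set" where
  "points \<Gamma> = Vertex ` verts \<Gamma> \<union> {Inner e t | e t. e \<in> edges \<Gamma> \<and> 0 < t \<and> t < len \<Gamma> e}"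

definition edge_point :: "('v, 'e) metric_graph \<Rightarrow> 'e \<Rightarrow> real \<Rightarrow> ('v, 'e) point" where
  "edge_point \<Gamma> e t =
     (if t \<le> 0 then Vertex (src \<Gamma> e) else if t \<ge> len \<Gamma> e then Vertex (tgt \<Gamma> e) else Inner e t)"

definition closed_edge :: "('v, 'e) metric_graph \<Rightarrow> 'e \<Rightarrow> ('v, 'e) point set" where
  "closed_edge \<Gamma> e = edge_point \<Gamma> e ` {0..len \<Gamma> e}"

text \<open>\<open>pl_path \<Gamma> p l q\<close>: there is a piecewise linear path of length \<open>l\<close> from \<open>p\<close> to \<open>q\<close>, that is, a
  finite concatenation of linear paths inside closed edges.\<close>

inductive pl_path ::
    "('v, 'e) metric_graph \<Rightarrow> ('v, 'e) point \<Rightarrow> real \<Rightarrow> ('v, 'e) point \<Rightarrow> bool" for \<Gamma> where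
  pl_path_refl: "p \<in> points \<Gamma> \<Longrightarrow> pl_path \<Gamma> p 0 p"
| pl_path_step: "pl_path \<Gamma> p l (edge_point \<Gamma> e s) \<Longrightarrow> e \<in> edges \<Gamma> \<Longrightarrow>
    s \<in> {0..len \<Gamma> e} \<Longrightarrow> t \<in> {0..len \<Gamma> e} \<Longrightarrow> pl_path \<Gamma> p (l + \<bar>s - t\<bar>) (edge_point \<Gamma> e t)"

text \<open>The value \<open>0\<close> for pairs not joined by a path is a dummy: it is never used on \<open>points \<Gamma>\<close>
  when \<open>\<Gamma>\<close> is connected.\<close>

definition path_dist :: "('v, 'e) metric_graph \<Rightarrow> ('v, 'e) point \<Rightarrow> ('v, 'e) point \<Rightarrow> real" where
  "path_dist \<Gamma> p q = (if \<exists>l. pl_path \<Gamma> p l q then Inf {l. pl_path \<Gamma> p l q} else 0)"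

text \<open>With infinitely many edges the infimum of the lengths of paths may be only a pseudometric;
  the last conjunct expresses that the path metric is a metric.\<close>

definition connected_metric_graph :: "('v, 'e) metric_graph \<Rightarrow> bool" where
  "connected_metric_graph \<Gamma> \<longleftrightarrow>
     (\<forall>e\<in>edges \<Gamma>. src \<Gamma> e \<in> verts \<Gamma> \<and> tgt \<Gamma> e \<in> verts \<Gamma> \<and> 0 < len \<Gamma> e) \<and>
     verts \<Gamma> \<noteq> {} \<and> (\<forall>p\<in>points \<Gamma>. \<forall>q\<in>points \<Gamma>. \<exists>l. pl_path \<Gamma> p l q) \<and>
     Metric_space (points \<Gamma>) (path_dist \<Gamma>)"

definition graph_topology :: "('v, 'e) metric_graph \<Rightarrow> ('v, 'e) point topology" where
  "graph_topology \<Gamma> = Metric_space.mtopology (points \<Gamma>) (path_dist \<Gamma>)"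

definition is_subgraph :: "('v, 'e) metric_graph \<Rightarrow> ('v, 'e) point set \<Rightarrow> bool" where
  "is_subgraph \<Gamma> \<Lambda> \<longleftrightarrow>
     (\<exists>V E. V \<subseteq> verts \<Gamma> \<and> E \<subseteq> edges \<Gamma> \<and> \<Lambda> = Vertex ` V \<union> (\<Union>e\<in>E. closed_edge \<Gamma> e))"

text \<open>Graph automorphisms as self-bijections of the realization; that closed edges are mapped onto
  closed edges encodes the preservation of incidence.\<close>

definition graph_automorphism ::
    "('v, 'e) metric_graph \<Rightarrow> (('v, 'e) point \<Rightarrow> ('v, 'e) point) \<Rightarrow> bool" where
  "graph_automorphism \<Gamma> f \<longleftrightarrow>
     bij_betw f (points \<Gamma>) (points \<Gamma>) \<and>
     f ` Vertex ` verts \<Gamma> = Vertex ` verts \<Gamma> \<and>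
     (\<lambda>e. f ` closed_edge \<Gamma> e) ` edges \<Gamma> = closed_edge \<Gamma> ` edges \<Gamma>"


section \<open>Coarse Cayley--Abels--Rosendal graphs\<close>

definition quotient_topology :: "'a topology \<Rightarrow> ('a \<Rightarrow> 'b) \<Rightarrow> 'b topology" where
  "quotient_topology X q =
     topology (\<lambda>U. U \<subseteq> q ` topspace X \<and> openin X {x \<in> topspace X. q x \<in> U})"

lemma openin_quotient_topology:
  "openin (quotient_topology X q) U \<longleftrightarrow>
     U \<subseteq> q ` topspace X \<and> openin X {x \<in> topspace X. q x \<in> U}"
proof -
  have "istopology (\<lambda>U. U \<subseteq> q ` topspace X \<and> openin X {x \<in> topspace X. q x \<in> U})"
    unfolding istopology_def
  proof (intro conjI allI impI)
    fix S T
    assume *: "S \<subseteq> q ` topspace X \<and> openin X {x \<in> topspace X. q x \<in> S}"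
      "T \<subseteq> q ` topspace X \<and> openin X {x \<in> topspace X. q x \<in> T}"
    have "{x \<in> topspace X. q x \<in> S \<inter> T} =
        {x \<in> topspace X. q x \<in> S} \<inter> {x \<in> topspace X. q x \<in> T}"
      by auto
    with * show "openin X {x \<in> topspace X. q x \<in> S \<inter> T}"
      by auto
    from * show "S \<inter> T \<subseteq> q ` topspace X" by blast
  next
    fix \<K>
    assume *: "\<forall>K\<in>\<K>. K \<subseteq> q ` topspace X \<and> openin X {x \<in> topspace X. q x \<in> K}"
    have "{x \<in> topspace X. q x \<in> \<Union>\<K>} = (\<Union>K\<in>\<K>. {x \<in> topspace X. q x \<in> K})"
      by auto
    with * show "openin X {x \<in> topspace X. q x \<in> \<Union>\<K>}"
      by auto
    from * show "\<Union>\<K> \<subseteq> q ` topspace X" by blast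
  qed
  then show ?thesis
    by (simp add: quotient_topology_def)
qed

lemma quotient_map_quotient_topology: "quotient_map X (quotient_topology X q) q"
proof -
  have "topspace (quotient_topology X q) = q ` topspace X"
  proof
    show "topspace (quotient_topology X q) \<subseteq> q ` topspace X"
      using openin_quotient_topology[of X q "topspace (quotient_topology X q)"] by simp
    have "{x \<in> topspace X. q x \<in> q ` topspace X} = topspace X"
      by auto
    then have "openin (quotient_topology X q) (q ` topspace X)"
      by (simp add: openin_quotient_topology)
    then show "q ` topspace X \<subseteq> topspace (quotient_topology X q)"
      by (rule openin_subset)
  qed
  then show ?thesis
    by (auto simp: quotient_map_def openin_quotient_topology)
qed

definition continuous_isometric_graph_action ::
    "('v, 'e) metric_graph \<Rightarrow>
     ('g::topological_group_add \<Rightarrow> ('v, 'e) point \<Rightarrow> ('v, 'e) point) \<Rightarrow> bool" where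
  "continuous_isometric_graph_action \<Gamma> act \<longleftrightarrow>
     (\<forall>p\<in>points \<Gamma>. act 0 p = p) \<and>
     (\<forall>g h. \<forall>p\<in>points \<Gamma>. act (g + h) p = act g (act h p)) \<and>
     (\<forall>g. graph_automorphism \<Gamma> (act g)) \<and>
     (\<forall>g. \<forall>p\<in>points \<Gamma>. \<forall>q\<in>points \<Gamma>. path_dist \<Gamma> (act g p) (act g q) = path_dist \<Gamma> p q) \<and>
     continuous_map (prod_topology euclidean (graph_topology \<Gamma>)) (graph_topology \<Gamma>)
       (\<lambda>(g, p). act g p)"

definition bounded_cocompact ::
    "('v, 'e) metric_graph \<Rightarrow> ('g \<Rightarrow> ('v, 'e) point \<Rightarrow> ('v, 'e) point) \<Rightarrow> bool" where
  "bounded_cocompact \<Gamma> act \<longleftrightarrow>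
     (\<forall>\<Lambda>. is_subgraph \<Gamma> \<Lambda> \<and> closedin (graph_topology \<Gamma>) \<Lambda> \<and>
          Metric_space.mbounded (points \<Gamma>) (path_dist \<Gamma>) \<Lambda> \<longrightarrow>
          compact_space
            (quotient_topology (subtopology (graph_topology \<Gamma>) (\<Union>g. act g ` \<Lambda>))
               (\<lambda>p. range (\<lambda>g. act g p))))"

definition coarse_CAR_graph ::
    "('v, 'e) metric_graph \<Rightarrow>
     ('g::topological_group_add \<Rightarrow> ('v, 'e) point \<Rightarrow> ('v, 'e) point) \<Rightarrow> bool" where
  "coarse_CAR_graph \<Gamma> act \<longleftrightarrow>
     connected_metric_graph \<Gamma> \<and>
     subtopology (graph_topology \<Gamma>) (Vertex ` verts \<Gamma>) = discrete_topology (Vertex ` verts \<Gamma>) \<and>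
     continuous_isometric_graph_action \<Gamma> act \<and>
     (\<forall>u\<in>verts \<Gamma>. \<forall>v\<in>verts \<Gamma>. \<exists>g. act g (Vertex u) = Vertex v) \<and>
     bounded_cocompact \<Gamma> act \<and>
     (\<forall>v\<in>verts \<Gamma>. coarsely_bounded {g. act g (Vertex v) = Vertex v})"

end

theory Submission
  imports Defs
begin

text \<open>Let \<open>\<Gamma>\<close> be a coarse Cayley--Abels--Rosendal graph of \<open>G\<close> and \<open>x\<close> a vertex. The action is continuous
  and the vertices are discrete, so the stabilizer of \<open>x\<close> is open. Being coarsely bounded, it witnesses
  that \<open>G\<close> is locally bounded. The orbit map is bornologous because the distance between \<open>g x\<close> and \<open>h x\<close> is a
  continuous left-invariant pseudometric in \<open>(g, h)\<close>.

  What remains is that a continuous left-invariant pseudometric \<open>d\<close> is bounded on the pairs \<open>(a, b)\<close> for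
  which \<open>a x\<close> and \<open>b x\<close> are at distance less than \<open>L\<close> (\<open>close_vertices_have_close_transporters\<close>). By
  transitivity distinct vertices are at distance at least some \<open>r > 0\<close>. Hence an edge that is not a loop
  has length at least \<open>r\<close>, and a path of length less than \<open>L\<close> between vertices traverses at most \<open>L / r\<close>
  such edges, each of length less than \<open>L\<close>. So it is enough to bound \<open>d\<close> across such edges
  (\<open>short_edges_uniformly_bounded\<close>). Up to translation they start or end at \<open>x\<close> and lie in a closed bounded
  subgraph, whose saturation has a compact quotient by hypothesis. Every edge has some finite value of
  \<open>d\<close> across it, and compactness makes these values uniformly bounded. The traversal of edges by a path is
  counted by a potential function on the graph (\<open>potential_le_path_length\<close>).

  Conversely, a non-Archimedean locally bounded group has a coarsely bounded open subgroup \<open>H\<close>. The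
  vertices of the graph are the cosets of \<open>H\<close>, and any two are joined by an edge. As \<open>G\<close> is separable,
  there are only countably many orbits of edges, and different lengths in \<open>{1, 2, 3, \<dots>}\<close> can be given to
  different orbits. A bounded subgraph then contains edges from finitely many orbits only, which is
  bounded cocompactness; the stabilizers of vertices are the conjugates of \<open>H\<close>. That the path metric is a
  metric with discrete vertices holds because all edges have length at least \<open>1\<close>.\<close>


section \<open>Paths in metric graphs\<close>

text \<open>The purely combinatorial part of being a connected metric graph. It is kept apart because the
  estimates below are what proves that the path metric of the coset graph is a metric.\<close>

definition wf_metric_graph :: "('v, 'e) metric_graph \<Rightarrow> bool" where
  "wf_metric_graph \<Gamma> \<longleftrightarrow>
     (\<forall>e\<in>edges \<Gamma>. src \<Gamma> e \<in> verts \<Gamma> \<and> tgt \<Gamma> e \<in> verts \<Gamma> \<and> 0 < len \<Gamma> e)"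

lemma wf_metric_graphD:
  assumes "wf_metric_graph \<Gamma>" "e \<in> edges \<Gamma>"
  shows "src \<Gamma> e \<in> verts \<Gamma>" "tgt \<Gamma> e \<in> verts \<Gamma>" "0 < len \<Gamma> e"
  using assms by (auto simp: wf_metric_graph_def)

lemma edge_point_in_points:
  assumes "wf_metric_graph \<Gamma>" "e \<in> edges \<Gamma>"
  shows "edge_point \<Gamma> e t \<in> points \<Gamma>"
  using wf_metric_graphD[OF assms] assms(2) by (auto simp: edge_point_def points_def)

lemma edge_point_simps:
  assumes "0 < len \<Gamma> e"
  shows "edge_point \<Gamma> e 0 = Vertex (src \<Gamma> e)" "edge_point \<Gamma> e (len \<Gamma> e) = Vertex (tgt \<Gamma> e)"
    "0 < t \<Longrightarrow> t < len \<Gamma> e \<Longrightarrow> edge_point \<Gamma> e t = Inner e t"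
  using assms by (auto simp: edge_point_def)

lemma pl_path_length_nonneg: "pl_path \<Gamma> p l q \<Longrightarrow> 0 \<le> l"
  by (induction rule: pl_path.induct) auto

lemma pl_path_edge:
  assumes "wf_metric_graph \<Gamma>" "e \<in> edges \<Gamma>" "s \<in> {0..len \<Gamma> e}" "t \<in> {0..len \<Gamma> e}"
  shows "pl_path \<Gamma> (edge_point \<Gamma> e s) \<bar>s - t\<bar> (edge_point \<Gamma> e t)"
  using pl_path_step[OF pl_path_refl[OF edge_point_in_points[OF assms(1,2)]] assms(2-4)] by simp

lemma pl_path_trans:
  assumes "pl_path \<Gamma> q m r" "pl_path \<Gamma> p l q"
  shows "pl_path \<Gamma> p (l + m) r"
  using assms
proof (induction)
  case (pl_path_step q m e s t)
  then have "pl_path \<Gamma> p ((l + m) + \<bar>s - t\<bar>) (edge_point \<Gamma> e t)"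
    by (intro pl_path.pl_path_step) auto
  then show ?case by (simp add: add.assoc)
qed simp

lemma pl_path_sym:
  assumes wf: "wf_metric_graph \<Gamma>" and "pl_path \<Gamma> p l q"
  shows "pl_path \<Gamma> q l p"
  using assms(2)
proof (induction)
  case (pl_path_step p l e s t)
  then show ?case
    using pl_path_trans[OF pl_path_step.IH pl_path_edge[OF wf, of e t s]]
    by (simp add: abs_minus_commute add.commute)
qed (rule pl_path_refl)

lemma path_dist_le: "pl_path \<Gamma> p l q \<Longrightarrow> path_dist \<Gamma> p q \<le> l"
  unfolding path_dist_def
  by (auto intro!: cInf_lower bdd_belowI[of _ 0] dest: pl_path_length_nonneg)

lemma path_dist_ge:
  assumes "\<exists>l. pl_path \<Gamma> p l q" "\<And>l. pl_path \<Gamma> p l q \<Longrightarrow> b \<le> l"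
  shows "b \<le> path_dist \<Gamma> p q"
  using assms unfolding path_dist_def by (auto intro!: cInf_greatest)

lemma pl_path_shorter_than:
  assumes "\<exists>l. pl_path \<Gamma> p l q" "path_dist \<Gamma> p q < a"
  obtains l where "pl_path \<Gamma> p l q" "l < a"
proof -
  have "Inf {l. pl_path \<Gamma> p l q} < a" "{l. pl_path \<Gamma> p l q} \<noteq> {}"
    using assms by (auto simp: path_dist_def split: if_splits)
  from cInf_lessD[OF this(2,1)] show ?thesis using that by auto
qed

lemma path_dist_edge_le:
  assumes "wf_metric_graph \<Gamma>" "e \<in> edges \<Gamma>" "s \<in> {0..len \<Gamma> e}" "t \<in> {0..len \<Gamma> e}"
  shows "path_dist \<Gamma> (edge_point \<Gamma> e s) (edge_point \<Gamma> e t) \<le> \<bar>s - t\<bar>"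
  by (rule path_dist_le[OF pl_path_edge[OF assms]])

lemma path_dist_sym:
  assumes "wf_metric_graph \<Gamma>"
  shows "path_dist \<Gamma> p q = path_dist \<Gamma> q p"
proof -
  have "pl_path \<Gamma> p l q = pl_path \<Gamma> q l p" for l using pl_path_sym[OF assms] by blast
  then show ?thesis by (simp add: path_dist_def)
qed

text \<open>Path lengths always give a pseudometric, so only the separation of points has to be supplied.\<close>

lemma path_dist_Metric_space:
  assumes wf: "wf_metric_graph \<Gamma>"
    and conn: "\<And>p q. p \<in> points \<Gamma> \<Longrightarrow> q \<in> points \<Gamma> \<Longrightarrow> \<exists>l. pl_path \<Gamma> p l q"
    and sep: "\<And>p q. p \<in> points \<Gamma> \<Longrightarrow> q \<in> points \<Gamma> \<Longrightarrow> p \<noteq> q \<Longrightarrow> 0 < path_dist \<Gamma> p q"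
  shows "Metric_space (points \<Gamma>) (path_dist \<Gamma>)"
proof
  have nonneg: "0 \<le> path_dist \<Gamma> p q" for p q
  proof (cases "\<exists>l. pl_path \<Gamma> p l q")
    case True
    then show ?thesis by (rule path_dist_ge) (rule pl_path_length_nonneg)
  qed (simp add: path_dist_def)
  show "0 \<le> path_dist \<Gamma> p q" for p q by (rule nonneg)
  show "path_dist \<Gamma> p q = path_dist \<Gamma> q p" for p q by (rule path_dist_sym[OF wf])
  show "(path_dist \<Gamma> p q = 0) = (p = q)" if "p \<in> points \<Gamma>" "q \<in> points \<Gamma>" for p q
  proof
    assume "p = q"
    then have "path_dist \<Gamma> p q \<le> 0" using path_dist_le[OF pl_path_refl[OF that(1)]] by simp
    then show "path_dist \<Gamma> p q = 0" using nonneg[of p q] by simp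
  qed (use sep[OF that] in auto)
  show "path_dist \<Gamma> p r \<le> path_dist \<Gamma> p q + path_dist \<Gamma> q r"
    if pqr: "p \<in> points \<Gamma>" "q \<in> points \<Gamma>" "r \<in> points \<Gamma>" for p q r
  proof (rule field_le_epsilon)
    fix \<epsilon> :: real assume "\<epsilon> > 0"
    obtain l where l: "pl_path \<Gamma> p l q" "l < path_dist \<Gamma> p q + \<epsilon> / 2"
      using pl_path_shorter_than[OF conn[OF pqr(1,2)], of "path_dist \<Gamma> p q + \<epsilon> / 2"] \<open>\<epsilon> > 0\<close>
      by auto
    obtain m where m: "pl_path \<Gamma> q m r" "m < path_dist \<Gamma> q r + \<epsilon> / 2"
      using pl_path_shorter_than[OF conn[OF pqr(2,3)], of "path_dist \<Gamma> q r + \<epsilon> / 2"] \<open>\<epsilon> > 0\<close>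
      by auto
    show "path_dist \<Gamma> p r \<le> path_dist \<Gamma> p q + path_dist \<Gamma> q r + \<epsilon>"
      using path_dist_le[OF pl_path_trans[OF m(1) l(1)]] l(2) m(2) by linarith
  qed
qed


section \<open>Lower bounds for the path metric\<close>

text \<open>A function that is 1-Lipschitz along every edge is 1-Lipschitz for the path metric. Lower bounds
  for distances come from this lemma by a choice of \<open>\<phi>\<close>.\<close>

lemma pl_path_Lipschitz:
  assumes "pl_path \<Gamma> p l q"
    and "\<And>e s t. e \<in> edges \<Gamma> \<Longrightarrow> s \<in> {0..len \<Gamma> e} \<Longrightarrow> t \<in> {0..len \<Gamma> e} \<Longrightarrow>
      \<phi> (edge_point \<Gamma> e s) - \<phi> (edge_point \<Gamma> e t) \<le> \<bar>s - t\<bar>"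
  shows "\<phi> p - \<phi> q \<le> l"
  using assms(1) by induction (use assms(2) in \<open>force+\<close>)

text \<open>A tent of height \<open>\<delta>\<close> with its peak at the point \<open>t\<close> of the edge \<open>e\<close>. If \<open>\<delta>\<close> is at most the distance
  from \<open>t\<close> to both ends, the tent vanishes at the ends and is thus 1-Lipschitz along all edges.\<close>

definition bump :: "'e \<Rightarrow> real \<Rightarrow> real \<Rightarrow> ('v, 'e) point \<Rightarrow> real" where
  "bump e t \<delta> p = (case p of Vertex v \<Rightarrow> 0
     | Inner e' s \<Rightarrow> if e' = e then max 0 (\<delta> - \<bar>s - t\<bar>) else 0)"

lemma bump_edge_point:
  assumes "\<delta> \<le> t" "\<delta> \<le> len \<Gamma> e - t" "s \<in> {0..len \<Gamma> e'}"
  shows "bump e t \<delta> (edge_point \<Gamma> e' s) = (if e' = e then max 0 (\<delta> - \<bar>s - t\<bar>) else 0)"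
  using assms by (auto simp: bump_def edge_point_def)

text \<open>For \<open>\<delta> > 0\<close> the peak is strict, so this bound separates an inner point from every other point of the graph;
  off the edge the tent is \<open>0\<close>, and the bound is the full height \<open>\<delta>\<close>.\<close>

lemma path_dist_inner_ge:
  fixes \<Gamma> :: "('v, 'e) metric_graph"
  assumes "0 \<le> \<delta>" "\<delta> \<le> t" "\<delta> \<le> len \<Gamma> e - t" and conn: "\<exists>l. pl_path \<Gamma> (Inner e t) l q"
  shows "\<delta> - bump e t \<delta> q \<le> path_dist \<Gamma> (Inner e t) q"
proof (rule path_dist_ge[OF conn])
  fix l assume l: "pl_path \<Gamma> (Inner e t) l q"
  have "bump e t \<delta> (Inner e t :: ('v, 'e) point) - bump e t \<delta> q \<le> l"
    by (rule pl_path_Lipschitz[OF l, where \<phi> = "bump e t \<delta>"])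
      (auto simp: bump_edge_point[OF assms(2,3)])
  moreover have "bump e t \<delta> (Inner e t :: ('v, 'e) point) = \<delta>"
    using assms(1) by (simp add: bump_def)
  ultimately show "\<delta> - bump e t \<delta> q \<le> l" by simp
qed

lemma path_dist_leave_edge_ge:
  assumes "0 < t" "t < len \<Gamma> e" "\<exists>l. pl_path \<Gamma> (Inner e t) l q" "\<And>s. q \<noteq> Inner e s"
  shows "min t (len \<Gamma> e - t) \<le> path_dist \<Gamma> (Inner e t) q"
proof -
  have "bump e t (min t (len \<Gamma> e - t)) q = 0"
    using assms(4) by (cases q) (auto simp: bump_def)
  with path_dist_inner_ge[of "min t (len \<Gamma> e - t)" t \<Gamma> e q] assms show ?thesis by auto
qed

text \<open>A quantitative form of ``a path of length at most \<open>L\<close> crosses few edges, all of length at most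
  \<open>L\<close>''. If the potential \<open>h\<close> of vertices changes by at most \<open>K\<close> times the length along every edge that a
  path of length at most \<open>L\<close> can traverse, then it grows at most at rate \<open>K\<close> along the path. Since a path
  may stop or turn round inside an edge, the induction has to speak of inner points as well: there the
  potential is the smaller of the two values obtained by going to that point from either end of its
  edge.\<close>

lemma potential_le_path_length:
  fixes \<Gamma> :: "('v, 'e) metric_graph" and h :: "'v \<Rightarrow> real"
  assumes "pl_path \<Gamma> (Vertex u) l q" "l \<le> L" "h u = 0" "0 < K"
    and wf: "wf_metric_graph \<Gamma>"
    and nonneg: "\<And>v. v \<in> verts \<Gamma> \<Longrightarrow> 0 \<le> h v"
    and edge: "\<And>e. e \<in> edges \<Gamma> \<Longrightarrow> len \<Gamma> e \<le> L \<Longrightarrow> \<bar>h (src \<Gamma> e) - h (tgt \<Gamma> e)\<bar> \<le> K * len \<Gamma> e"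
  shows "case q of Vertex v \<Rightarrow> h v \<le> K * l
     | Inner e t \<Rightarrow> min (h (src \<Gamma> e) + K * t) (h (tgt \<Gamma> e) + K * (len \<Gamma> e - t)) \<le> K * l"
  using assms(1,2)
proof (induction "Vertex u :: ('v, 'e) point" l q rule: pl_path.induct)
  case pl_path_refl
  then show ?case using assms by simp
next
  case (pl_path_step l e s t)
  \<comment> \<open>The potential along \<open>e\<close>, as seen from the two ends.\<close>
  define H where "H = (\<lambda>t. min (h (src \<Gamma> e) + K * t) (h (tgt \<Gamma> e) + K * (len \<Gamma> e - t)))"
  note e = wf_metric_graphD[OF wf \<open>e \<in> edges \<Gamma>\<close>]
  let ?l = "l + \<bar>s - t\<bar>"
  have "l \<le> L" using pl_path_step.prems by simp
  then have "H s \<le> K * l"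
    using pl_path_step.hyps(2) pl_path_step.hyps(4) by (auto simp: H_def edge_point_def split: if_splits)
  moreover have "H t \<le> H s + K * \<bar>s - t\<bar>"
  proof -
    have "K * t \<le> K * s + K * \<bar>s - t\<bar>" "K * s \<le> K * t + K * \<bar>s - t\<bar>"
      using \<open>0 < K\<close> by (simp_all flip: distrib_left)
    then show ?thesis by (auto simp: H_def right_diff_distrib)
  qed
  ultimately have H: "H t \<le> K * ?l" by (simp add: distrib_left)
  \<comment> \<open>If the minimum at one end is attained by the value coming from the other end, then the path was
      long enough to traverse \<open>e\<close>; so \<open>e\<close> has length at most \<open>L\<close>, and the hypothesis on edges applies.\<close>
  have vertex: "h a \<le> K * ?l" if "h b + K * len \<Gamma> e \<le> K * ?l" "b \<in> verts \<Gamma>"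
    "a = src \<Gamma> e \<and> b = tgt \<Gamma> e \<or> b = src \<Gamma> e \<and> a = tgt \<Gamma> e" for a b
  proof -
    have "K * len \<Gamma> e \<le> K * ?l" using that(1) nonneg[OF that(2)] by simp
    then have "len \<Gamma> e \<le> L" using \<open>0 < K\<close> pl_path_step.prems by simp
    from edge[OF \<open>e \<in> edges \<Gamma>\<close> this] that(1,3) show ?thesis by auto
  qed
  show ?case
  proof (cases "t = 0 \<or> t = len \<Gamma> e")
    case True
    then show ?thesis
      using H e vertex[of "tgt \<Gamma> e" "src \<Gamma> e"] vertex[of "src \<Gamma> e" "tgt \<Gamma> e"]
      by (auto simp: H_def edge_point_simps min_def split: if_splits)
  next
    case False
    then show ?thesis using H e pl_path_step.hyps(5) by (auto simp: H_def edge_point_simps)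
  qed
qed

text \<open>The potential that is \<open>0\<close> at \<open>v\<close> and \<open>r\<close> at all other vertices changes by at most the length along
  each edge.\<close>

lemma path_dist_isolated_vertex_ge:
  assumes wf: "wf_metric_graph \<Gamma>"
    and r: "0 < r" "\<And>e. e \<in> edges \<Gamma> \<Longrightarrow> src \<Gamma> e \<noteq> tgt \<Gamma> e \<Longrightarrow> r \<le> len \<Gamma> e"
    and conn: "\<exists>l. pl_path \<Gamma> (Vertex v) l q"
    and q: "case q of Vertex u \<Rightarrow> u \<noteq> v
      | Inner e t \<Rightarrow> src \<Gamma> e \<noteq> v \<and> tgt \<Gamma> e \<noteq> v \<and> 0 \<le> t \<and> t \<le> len \<Gamma> e"
  shows "r \<le> path_dist \<Gamma> (Vertex v) q"
proof (rule path_dist_ge[OF conn])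
  fix l assume l: "pl_path \<Gamma> (Vertex v) l q"
  define h where "h = (\<lambda>u. if u = v then 0 else r)"
  have "\<bar>h (src \<Gamma> e) - h (tgt \<Gamma> e)\<bar> \<le> 1 * len \<Gamma> e" if "e \<in> edges \<Gamma>" for e
    using r(1) r(2)[OF that] wf_metric_graphD(3)[OF wf that] by (auto simp: h_def)
  moreover have "h v = 0" "\<And>u. 0 \<le> h u" using r(1) by (simp_all add: h_def)
  ultimately have "case q of Vertex u \<Rightarrow> h u \<le> 1 * l
     | Inner e t \<Rightarrow> min (h (src \<Gamma> e) + 1 * t) (h (tgt \<Gamma> e) + 1 * (len \<Gamma> e - t)) \<le> 1 * l"
    by (intro potential_le_path_length[OF l order_refl _ _ wf]) simp_all
  then show "r \<le> l" using q by (auto simp: h_def min_def split: point.splits if_splits)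
qed


section \<open>The topology of a metric graph\<close>

locale metric_graph_space =
  fixes \<Gamma> :: "('v, 'e) metric_graph"
  assumes connected: "connected_metric_graph \<Gamma>"
begin

lemma wf: "wf_metric_graph \<Gamma>"
  using connected by (auto simp: connected_metric_graph_def wf_metric_graph_def)

lemma path_exists: "p \<in> points \<Gamma> \<Longrightarrow> q \<in> points \<Gamma> \<Longrightarrow> \<exists>l. pl_path \<Gamma> p l q"
  using connected by (auto simp: connected_metric_graph_def)

lemma vertex_in_points [simp]: "Vertex v \<in> points \<Gamma> \<longleftrightarrow> v \<in> verts \<Gamma>"
  by (auto simp: points_def)

lemma inner_in_points: "Inner e t \<in> points \<Gamma> \<longleftrightarrow> e \<in> edges \<Gamma> \<and> 0 < t \<and> t < len \<Gamma> e"
  by (auto simp: points_def)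

lemma closed_edge_eq:
  assumes "e \<in> edges \<Gamma>"
  shows "closed_edge \<Gamma> e =
    {Vertex (src \<Gamma> e), Vertex (tgt \<Gamma> e)} \<union> {Inner e t | t. 0 < t \<and> t < len \<Gamma> e}"
proof -
  have e: "0 < len \<Gamma> e" by (rule wf_metric_graphD[OF wf assms])
  have "closed_edge \<Gamma> e \<subseteq>
    {Vertex (src \<Gamma> e), Vertex (tgt \<Gamma> e)} \<union> {Inner e t | t. 0 < t \<and> t < len \<Gamma> e}"
    by (auto simp: closed_edge_def edge_point_def)
  moreover have "Vertex (src \<Gamma> e) \<in> closed_edge \<Gamma> e" "Vertex (tgt \<Gamma> e) \<in> closed_edge \<Gamma> e"
    "Inner e t \<in> closed_edge \<Gamma> e" if "0 < t" "t < len \<Gamma> e" for t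
    unfolding closed_edge_def
    using edge_point_simps[OF e] e that by (metis atLeastAtMost_iff image_eqI less_eq_real_def)+
  moreover have "0 < len \<Gamma> e / 2" "len \<Gamma> e / 2 < len \<Gamma> e" using e by auto
  ultimately show ?thesis by blast
qed

lemma closed_edge_subset: "e \<in> edges \<Gamma> \<Longrightarrow> closed_edge \<Gamma> e \<subseteq> points \<Gamma>"
  by (auto simp: closed_edge_def intro: edge_point_in_points[OF wf])

end

sublocale metric_graph_space \<subseteq> Metric_space "points \<Gamma>" "path_dist \<Gamma>"
  using connected by (simp add: connected_metric_graph_def)

context metric_graph_space
begin

lemma topspace_graph_topology [simp]: "topspace (graph_topology \<Gamma>) = points \<Gamma>"
  by (simp add: graph_topology_def)

lemma path_dist_midpoint_vertex:
  assumes "e \<in> edges \<Gamma>" "v \<in> verts \<Gamma>"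
  shows "len \<Gamma> e / 2 \<le> path_dist \<Gamma> (Inner e (len \<Gamma> e / 2)) (Vertex v)"
proof -
  have "0 < len \<Gamma> e" by (rule wf_metric_graphD[OF wf assms(1)])
  then show ?thesis
    using path_dist_leave_edge_ge[of "len \<Gamma> e / 2" \<Gamma> e "Vertex v"] assms
      path_exists[of "Inner e (len \<Gamma> e / 2)" "Vertex v"]
    by (auto simp: inner_in_points)
qed

text \<open>A path from an inner point to a point off its open edge has to reach an end of that edge.\<close>

lemma openin_union_open_edges:
  assumes "S \<subseteq> edges \<Gamma>"
  shows "openin (graph_topology \<Gamma>) {Inner e t | e t. e \<in> S \<and> 0 < t \<and> t < len \<Gamma> e}"
    (is "openin _ ?U")
  unfolding graph_topology_def openin_mtopology
proof (intro conjI ballI allI impI)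
  show "?U \<subseteq> points \<Gamma>" using assms by (auto simp: inner_in_points)
  fix p assume "p \<in> ?U"
  then obtain e t where p: "p = Inner e t" "e \<in> S" "0 < t" "t < len \<Gamma> e" by auto
  have "mball p (min t (len \<Gamma> e - t)) \<subseteq> ?U"
  proof
    fix q assume "q \<in> mball p (min t (len \<Gamma> e - t))"
    then have q: "q \<in> points \<Gamma>" "p \<in> points \<Gamma>" "path_dist \<Gamma> p q < min t (len \<Gamma> e - t)"
      by auto
    have "\<exists>s. q = Inner e s"
    proof (rule ccontr)
      assume "\<nexists>s. q = Inner e s"
      then have "min t (len \<Gamma> e - t) \<le> path_dist \<Gamma> p q"
        using path_dist_leave_edge_ge[of t \<Gamma> e q] path_exists[OF q(2,1)] p by auto
      with q(3) show False by (simp add: min_def split: if_splits)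
    qed
    then obtain s where "q = Inner e s" by blast
    with q p show "q \<in> ?U" by (auto simp: inner_in_points)
  qed
  then show "\<exists>r>0. mball p r \<subseteq> ?U" using p by (intro exI[of _ "min t (len \<Gamma> e - t)"]) auto
qed

lemma openin_union_mball: "openin (graph_topology \<Gamma>) (\<Union>v\<in>V. mball (f v) r)"
  unfolding graph_topology_def by (intro openin_Union) auto

end


section \<open>Invariant covers of compact quotients\<close>

lemma topspace_quotient_topology [simp]: "topspace (quotient_topology X q) = q ` topspace X"
  using quotient_map_quotient_topology[of X q] by (simp add: quotient_map_def)

text \<open>Saturated open sets are the preimages of the open sets of the quotient, so compactness of the
  quotient applies to covers of \<open>X\<close> by such sets.\<close>

lemma compact_quotient_increasing_cover:
  fixes U :: "nat \<Rightarrow> 'a set"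
  assumes compact: "compact_space (quotient_topology X q)"
    and U: "\<And>n. openin X (U n)" "\<And>m n. m \<le> n \<Longrightarrow> U m \<subseteq> U n" "topspace X \<subseteq> (\<Union>n. U n)"
    and saturated: "\<And>n x y. x \<in> U n \<Longrightarrow> y \<in> topspace X \<Longrightarrow> q y = q x \<Longrightarrow> y \<in> U n"
  obtains n where "topspace X \<subseteq> U n"
proof -
  let ?\<U> = "range (\<lambda>n. q ` U n)"
  have sub: "U n \<subseteq> topspace X" for n by (rule openin_subset[OF U(1)])
  have op: "openin (quotient_topology X q) (q ` U n)" for n
  proof -
    have "{x \<in> topspace X. q x \<in> q ` U n} = U n"
    proof
      show "{x \<in> topspace X. q x \<in> q ` U n} \<subseteq> U n" by (clarsimp, rule saturated)
    qed (use sub[of n] in auto)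
    then show ?thesis using U(1)[of n] image_mono[OF sub[of n], of q]
      by (simp add: openin_quotient_topology)
  qed
  have "q ` topspace X \<subseteq> (\<Union>n. q ` U n)" using image_mono[OF U(3), of q] by (simp add: image_UN)
  then obtain \<F> where F: "finite \<F>" "\<F> \<subseteq> ?\<U>" "q ` topspace X \<subseteq> \<Union>\<F>"
    using spec[OF compact[unfolded compact_space_alt topspace_quotient_topology], of ?\<U>] op
    by (elim impE exE) auto
  obtain N where N: "finite N" "\<F> = (\<lambda>n. q ` U n) ` N"
    using finite_subset_image[OF F(1,2)] by auto
  obtain n where n: "\<And>m. m \<in> N \<Longrightarrow> m \<le> n" using N(1)[unfolded finite_nat_set_iff_bounded_le] by blast
  have "x \<in> U n" if x: "x \<in> topspace X" for x
  proof -
    obtain m y where y: "m \<in> N" "y \<in> U m" "q x = q y"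
      using subsetD[OF F(3) imageI[OF x]] unfolding N(2) by blast
    then have "x \<in> U m" using saturated[OF _ x] by blast
    then show ?thesis using U(2)[OF n[OF y(1)]] by blast
  qed
  then show ?thesis using that[of n] by (simp add: subset_iff)
qed


section \<open>Orbit maps are coarse equivalences\<close>

lemma pseudometricD:
  assumes "cont_left_invariant_pseudometric d"
  shows "d x x = 0" "0 \<le> d x y" "d x y = d y x" "d x z \<le> d x y + d y z" "d (g + x) (g + y) = d x y"
  using assms by (auto simp: cont_left_invariant_pseudometric_def pseudometric_def)

lemma left_coarse_iff:
  "E \<in> left_coarse \<longleftrightarrow>
     (\<forall>d. cont_left_invariant_pseudometric d \<longrightarrow> (\<exists>\<alpha>. \<forall>(x, y)\<in>E. d x y < \<alpha>))"
  by (auto simp: left_coarse_def metric_coarse_def)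

lemma coarsely_bounded_iff:
  "coarsely_bounded A \<longleftrightarrow>
     (\<forall>d. cont_left_invariant_pseudometric d \<longrightarrow> (\<exists>\<alpha>. \<forall>x\<in>A. \<forall>y\<in>A. d x y < \<alpha>))"
  unfolding coarsely_bounded_def left_coarse_iff by auto

lemma coarsely_bounded_subset: "coarsely_bounded B \<Longrightarrow> A \<subseteq> B \<Longrightarrow> coarsely_bounded A"
  unfolding coarsely_bounded_iff subset_iff by fast

locale CAR_graph =
  fixes \<Gamma> :: "('v, 'e) metric_graph"
    and act :: "'g::topological_group_add \<Rightarrow> ('v, 'e) point \<Rightarrow> ('v, 'e) point"
  assumes car: "coarse_CAR_graph \<Gamma> act"

sublocale CAR_graph \<subseteq> metric_graph_space \<Gamma>
  by unfold_locales (use car in \<open>simp add: coarse_CAR_graph_def\<close>)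

context CAR_graph
begin

lemma act_zero: "p \<in> points \<Gamma> \<Longrightarrow> act 0 p = p"
  and act_add: "p \<in> points \<Gamma> \<Longrightarrow> act (g + h) p = act g (act h p)"
  and act_isometry: "p \<in> points \<Gamma> \<Longrightarrow> q \<in> points \<Gamma> \<Longrightarrow>
    path_dist \<Gamma> (act g p) (act g q) = path_dist \<Gamma> p q"
  and act_automorphism: "graph_automorphism \<Gamma> (act g)"
  and act_continuous: "continuous_map (prod_topology euclidean (graph_topology \<Gamma>))
    (graph_topology \<Gamma>) (\<lambda>(g, p). act g p)"
  using car unfolding coarse_CAR_graph_def continuous_isometric_graph_action_def by blast+

lemma act_in_points: "p \<in> points \<Gamma> \<Longrightarrow> act g p \<in> points \<Gamma>"
  using act_automorphism[of g] unfolding graph_automorphism_def by (auto dest: bij_betwE)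

lemma act_inj: "inj_on (act g) (points \<Gamma>)"
  using act_automorphism[of g] unfolding graph_automorphism_def by (auto dest: bij_betw_imp_inj_on)

lemma act_minus: "p \<in> points \<Gamma> \<Longrightarrow> act (- g) (act g p) = p" "p \<in> points \<Gamma> \<Longrightarrow> act g (act (- g) p) = p"
  using act_add[of p "- g" g] act_add[of p g "- g"] act_zero by auto

lemma act_vertices: "act g ` Vertex ` verts \<Gamma> = Vertex ` verts \<Gamma>"
  using act_automorphism[of g] unfolding graph_automorphism_def by blast

lemma act_vertex:
  assumes "v \<in> verts \<Gamma>"
  obtains w where "w \<in> verts \<Gamma>" "act g (Vertex v) = Vertex w"
  using act_vertices[of g] assms by blast

lemma transitive:
  assumes "u \<in> verts \<Gamma>" "v \<in> verts \<Gamma>"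
  obtains g where "act g (Vertex u) = Vertex v"
  using car assms unfolding coarse_CAR_graph_def by blast

text \<open>An automorphism permutes closed edges, vertices and hence inner points. So it takes the ends of an
  edge to the ends of one single edge, and all inner points to inner points of that edge.\<close>

lemma act_edge:
  assumes e: "e \<in> edges \<Gamma>"
  obtains e' where "e' \<in> edges \<Gamma>" "act g ` closed_edge \<Gamma> e = closed_edge \<Gamma> e'"
    "{act g (Vertex (src \<Gamma> e)), act g (Vertex (tgt \<Gamma> e))} = {Vertex (src \<Gamma> e'), Vertex (tgt \<Gamma> e')}"
    "\<And>t. 0 < t \<Longrightarrow> t < len \<Gamma> e \<Longrightarrow> \<exists>s. 0 < s \<and> s < len \<Gamma> e' \<and> act g (Inner e t) = Inner e' s"
proof -
  obtain e' where e': "e' \<in> edges \<Gamma>" "act g ` closed_edge \<Gamma> e = closed_edge \<Gamma> e'"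
  proof -
    have "act g ` closed_edge \<Gamma> e \<in> (\<lambda>e. act g ` closed_edge \<Gamma> e) ` edges \<Gamma>" using e by blast
    also have "\<dots> = closed_edge \<Gamma> ` edges \<Gamma>"
      using act_automorphism[of g] by (simp add: graph_automorphism_def)
    finally show ?thesis by (rule imageE) (rule that)
  qed
  have V: "Vertex ` verts \<Gamma> \<subseteq> points \<Gamma>" by auto
  have ends: "closed_edge \<Gamma> a \<inter> Vertex ` verts \<Gamma> = {Vertex (src \<Gamma> a), Vertex (tgt \<Gamma> a)}"
    and inner: "closed_edge \<Gamma> a - Vertex ` verts \<Gamma> = {Inner a t | t. 0 < t \<and> t < len \<Gamma> a}"
    if "a \<in> edges \<Gamma>" for a
    using wf_metric_graphD[OF wf that] by (auto simp: closed_edge_eq[OF that])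
  have "act g ` (closed_edge \<Gamma> e \<inter> Vertex ` verts \<Gamma>) = closed_edge \<Gamma> e' \<inter> Vertex ` verts \<Gamma>"
    by (simp only: inj_on_image_Int[OF act_inj closed_edge_subset[OF e] V] e'(2) act_vertices)
  then have 1: "{act g (Vertex (src \<Gamma> e)), act g (Vertex (tgt \<Gamma> e))}
      = {Vertex (src \<Gamma> e'), Vertex (tgt \<Gamma> e')}"
    by (simp add: ends e e'(1))
  have "act g ` (closed_edge \<Gamma> e - Vertex ` verts \<Gamma>) = closed_edge \<Gamma> e' - Vertex ` verts \<Gamma>"
    using closed_edge_subset[OF e]
    by (subst inj_on_image_set_diff[OF act_inj _ V]) (auto simp only: e'(2) act_vertices)
  then have 2: "act g ` {Inner e t | t. 0 < t \<and> t < len \<Gamma> e} = {Inner e' t | t. 0 < t \<and> t < len \<Gamma> e'}"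
    by (simp add: inner e e'(1))
  show ?thesis 
  proof (rule that[OF e' 1])
    fix t assume "0 < t" "t < len \<Gamma> e"
    then have "act g (Inner e t) \<in> act g ` {Inner e t | t. 0 < t \<and> t < len \<Gamma> e}" by blast
    then show "\<exists>s. 0 < s \<and> s < len \<Gamma> e' \<and> act g (Inner e t) = Inner e' s" unfolding 2 by blast
  qed
qed

text \<open>By discreteness some ball around one vertex contains no other vertex, and transitivity moves
  this ball to every vertex.\<close>

lemma vertex_gap:
  obtains r where "0 < r"
    "\<And>u v. u \<in> verts \<Gamma> \<Longrightarrow> v \<in> verts \<Gamma> \<Longrightarrow> u \<noteq> v \<Longrightarrow> r \<le> path_dist \<Gamma> (Vertex u) (Vertex v)"
    "\<And>e. e \<in> edges \<Gamma> \<Longrightarrow> src \<Gamma> e \<noteq> tgt \<Gamma> e \<Longrightarrow> r \<le> len \<Gamma> e"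
proof -
  obtain x where x: "x \<in> verts \<Gamma>" using connected by (auto simp: connected_metric_graph_def)
  have "openin (subtopology (graph_topology \<Gamma>) (Vertex ` verts \<Gamma>)) {Vertex x}"
    using car x by (simp add: coarse_CAR_graph_def)
  then obtain U where U: "openin (graph_topology \<Gamma>) U" "{Vertex x} = U \<inter> Vertex ` verts \<Gamma>"
    by (auto simp: openin_subtopology)
  then have "Vertex x \<in> U" by auto
  then obtain r where r: "r > 0" "mball (Vertex x) r \<subseteq> U"
    using U(1) by (auto simp: graph_topology_def openin_mtopology)
  have at_x: "r \<le> path_dist \<Gamma> (Vertex x) (Vertex v)" if "v \<in> verts \<Gamma>" "v \<noteq> x" for v
  proof (rule ccontr)
    assume "\<not> ?thesis"
    then have "Vertex v \<in> mball (Vertex x) r" using that x by auto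
    then show False using r U(2) that by blast
  qed
  have gap: "r \<le> path_dist \<Gamma> (Vertex u) (Vertex v)"
    if uv: "u \<in> verts \<Gamma>" "v \<in> verts \<Gamma>" "u \<noteq> v" for u v
  proof -
    obtain g where g: "act g (Vertex u) = Vertex x" using transitive uv x by metis
    obtain w where w: "w \<in> verts \<Gamma>" "act g (Vertex v) = Vertex w" using act_vertex uv by metis
    have "w \<noteq> x" using inj_onD[OF act_inj, of g "Vertex u" "Vertex v"] uv g w by auto
    then show ?thesis
      using at_x[OF w(1)] act_isometry[of "Vertex u" "Vertex v" g] uv g w by simp
  qed
  show ?thesis
  proof (rule that[OF r(1) gap])
    fix e assume e: "e \<in> edges \<Gamma>" "src \<Gamma> e \<noteq> tgt \<Gamma> e"
    show "r \<le> len \<Gamma> e"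
      using gap[of "src \<Gamma> e" "tgt \<Gamma> e"] path_dist_edge_le[OF wf e(1), of 0 "len \<Gamma> e"] e
        wf_metric_graphD[OF wf e(1)] by (auto simp: edge_point_simps)
  qed
qed

text \<open>The orbit map of a vertex is continuous into a discrete space, hence locally constant.\<close>

lemma open_vertex_transporter:
  assumes "x \<in> verts \<Gamma>"
  shows "open {g. act g (Vertex x) = p}"
proof -
  define D where "D = subtopology (graph_topology \<Gamma>) (Vertex ` verts \<Gamma>)"
  have D: "D = discrete_topology (Vertex ` verts \<Gamma>)"
    using car by (simp add: coarse_CAR_graph_def D_def)
  have "continuous_map euclidean (prod_topology euclidean (graph_topology \<Gamma>)) (\<lambda>g. (g, Vertex x))"
    using assms by (simp add: continuous_map_pairwise o_def)
  from continuous_map_compose[OF this act_continuous]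
  have "continuous_map euclidean (graph_topology \<Gamma>) (\<lambda>g. act g (Vertex x))"
    by (simp add: o_def)
  then have c: "continuous_map euclidean D (\<lambda>g. act g (Vertex x))"
    unfolding D_def
  proof (rule continuous_map_into_subtopology)
    show "(\<lambda>g. act g (Vertex x)) \<in> topspace euclidean \<rightarrow> Vertex ` verts \<Gamma>"
    proof (rule Pi_I)
      show "act g (Vertex x) \<in> Vertex ` verts \<Gamma>" for g
        by (rule act_vertex[OF assms, of g]) simp
    qed
  qed
  show ?thesis
  proof (cases "p \<in> Vertex ` verts \<Gamma>")
    case True
    then have "openin D {p}" by (simp add: D)
    from openin_continuous_map_preimage[OF c this] show ?thesis by (simp flip: open_openin)
  next
    case False
    then have "{g. act g (Vertex x) = p} = {}" using act_vertex[OF assms] by blast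
    then show ?thesis by (metis open_empty)
  qed
qed

lemma stabilizer_bounded:
  assumes "x \<in> verts \<Gamma>"
  shows "coarsely_bounded {g. act g (Vertex x) = Vertex x}"
  using car assms by (simp add: coarse_CAR_graph_def)

lemma locally_bounded: "locally_bounded TYPE('g)"
proof -
  obtain x where x: "x \<in> verts \<Gamma>" using connected by (auto simp: connected_metric_graph_def)
  have "0 \<in> interior {g. act g (Vertex x) = Vertex x}"
    using interior_open[OF open_vertex_transporter[OF x]] act_zero x by auto
  with stabilizer_bounded[OF x] show ?thesis by (auto simp: locally_bounded_def)
qed

text \<open>By left invariance, two elements with the same value under the orbit map are as far apart as the
  identity and an element of the stabilizer.\<close>

lemma stabilizer_diameter:
  assumes d: "cont_left_invariant_pseudometric d" and x: "x \<in> verts \<Gamma>"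
  obtains M where "0 < M"
    "\<And>a b. act a (Vertex x) = act b (Vertex x) \<Longrightarrow> d a b \<le> M"
proof -
  obtain M where M: "\<And>a b. act a (Vertex x) = Vertex x \<Longrightarrow> act b (Vertex x) = Vertex x \<Longrightarrow> d a b < M"
    using stabilizer_bounded[OF x] d unfolding coarsely_bounded_iff by blast
  have "d a b \<le> M" if "act a (Vertex x) = act b (Vertex x)" for a b
  proof -
    have "act (- a + b) (Vertex x) = Vertex x"
      using act_add[of "Vertex x" "- a" b] act_minus[of "Vertex x" a] that x by simp
    then have "d 0 (- a + b) < M" using M act_zero x by auto
    moreover have "d a b = d 0 (- a + b)"
      using pseudometricD(5)[OF d, of "- a" a b] by simp
    ultimately show ?thesis by simp
  qed
  moreover have "0 < M" using M[of 0 0] pseudometricD(1)[OF d] act_zero x by auto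
  ultimately show ?thesis using that by blast
qed

text \<open>A vertex outside the union stays at distance at least \<open>r\<close> from it, where \<open>r\<close> is the gap between
  vertices: from such a vertex, a point of the union can be reached only through another vertex. The
  remaining points of the complement lie on open edges.\<close>

lemma closedin_union_closed_edges:
  assumes S: "S \<subseteq> edges \<Gamma>"
  shows "closedin (graph_topology \<Gamma>) (\<Union>e\<in>S. closed_edge \<Gamma> e)" (is "closedin _ ?\<Lambda>")
proof -
  obtain r where r: "0 < r" "\<And>e. e \<in> edges \<Gamma> \<Longrightarrow> src \<Gamma> e \<noteq> tgt \<Gamma> e \<Longrightarrow> r \<le> len \<Gamma> e"
    by (rule vertex_gap) blast
  define V where "V = {v \<in> verts \<Gamma>. Vertex v \<notin> ?\<Lambda>}"
  define I :: "('v, 'e) point set"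
    where "I = {Inner e t | e t. e \<in> edges \<Gamma> - S \<and> 0 < t \<and> t < len \<Gamma> e}"
  have far: "q \<notin> ?\<Lambda>" if v: "v \<in> V" and q: "q \<in> mball (Vertex v) r" for v q
  proof
    assume "q \<in> ?\<Lambda>"
    then obtain e where e: "e \<in> S" "q \<in> closed_edge \<Gamma> e" by auto
    with S have e': "e \<in> edges \<Gamma>" by blast
    have ne: "src \<Gamma> e \<noteq> v" "tgt \<Gamma> e \<noteq> v"
      using v e(1) closed_edge_eq[OF e'] by (auto simp: V_def)
    have "r \<le> path_dist \<Gamma> (Vertex v) q"
    proof (rule path_dist_isolated_vertex_ge[OF wf r])
      show "\<exists>l. pl_path \<Gamma> (Vertex v) l q" using q by (intro path_exists) auto
      show "case q of Vertex u \<Rightarrow> u \<noteq> v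
        | Inner e t \<Rightarrow> src \<Gamma> e \<noteq> v \<and> tgt \<Gamma> e \<noteq> v \<and> 0 \<le> t \<and> t \<le> len \<Gamma> e"
        using e(2) ne by (auto simp: closed_edge_eq[OF e'])
    qed
    then show False using q by auto
  qed
  have "points \<Gamma> - ?\<Lambda> = I \<union> (\<Union>v\<in>V. mball (Vertex v) r)"
  proof
    show "points \<Gamma> - ?\<Lambda> \<subseteq> I \<union> (\<Union>v\<in>V. mball (Vertex v) r)"
    proof
      fix p assume p: "p \<in> points \<Gamma> - ?\<Lambda>"
      show "p \<in> I \<union> (\<Union>v\<in>V. mball (Vertex v) r)"
      proof (cases p)
        case (Vertex v)
        then have "v \<in> V" "Vertex v \<in> mball (Vertex v) r" using p r(1) by (auto simp: V_def)
        then show ?thesis using Vertex by blast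
      next
        case (Inner e t)
        then have "e \<in> edges \<Gamma>" "0 < t" "t < len \<Gamma> e" "e \<notin> S"
          using p closed_edge_eq[of e] by (auto simp: inner_in_points)
        then show ?thesis using Inner by (auto simp: I_def)
      qed
    qed
    have "I \<inter> ?\<Lambda> = {}" using S by (auto simp: I_def closed_edge_eq subset_iff)
    moreover have "I \<subseteq> points \<Gamma>" by (auto simp: I_def inner_in_points)
    ultimately show "I \<union> (\<Union>v\<in>V. mball (Vertex v) r) \<subseteq> points \<Gamma> - ?\<Lambda>"
      using far by auto
  qed
  moreover have "openin (graph_topology \<Gamma>) (I \<union> (\<Union>v\<in>V. mball (Vertex v) r))"
    unfolding I_def by (intro openin_Un openin_union_open_edges openin_union_mball) auto
  moreover have "?\<Lambda> \<subseteq> points \<Gamma>" using closed_edge_subset S by blast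
  ultimately show ?thesis by (simp add: closedin_def)
qed

text \<open>This is where cocompactness enters. Every edge in question has a translate at \<open>x\<close>, and the translates
  at \<open>x\<close> lie in a closed bounded subgraph \<open>\<Lambda>\<close>. Its saturation \<open>G\<Lambda>\<close> has an increasing open cover by invariant
  sets \<open>U n\<close>: the inner points of those edges whose ends are reached from \<open>x\<close> by two elements at
  \<open>d\<close>-distance less than \<open>n\<close>, together with small balls around all vertices. Some \<open>U n\<close> contains \<open>G\<Lambda>\<close>, in
  particular the midpoints of all edges in question, and these lie outside the small balls.\<close>

lemma short_edges_uniformly_bounded:
  assumes d: "cont_left_invariant_pseudometric d" and x: "x \<in> verts \<Gamma>"
  obtains n :: nat where
    "\<And>e. e \<in> edges \<Gamma> \<Longrightarrow> src \<Gamma> e \<noteq> tgt \<Gamma> e \<Longrightarrow> len \<Gamma> e \<le> L \<Longrightarrow>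
       \<exists>a b. act a (Vertex x) = Vertex (src \<Gamma> e) \<and> act b (Vertex x) = Vertex (tgt \<Gamma> e) \<and> d a b < n"
proof -
  obtain r where r: "0 < r" "\<And>e. e \<in> edges \<Gamma> \<Longrightarrow> src \<Gamma> e \<noteq> tgt \<Gamma> e \<Longrightarrow> r \<le> len \<Gamma> e"
    by (rule vertex_gap) blast
  \<comment> \<open>Size is measured by a ball around \<open>x\<close>, and not by the length of the edge, because isometries
      visibly preserve the former. Loops are left out: they may be arbitrarily short, so that their
      midpoints may lie in the small balls.\<close>
  define S where "S = {e \<in> edges \<Gamma>. src \<Gamma> e \<noteq> tgt \<Gamma> e \<and> (src \<Gamma> e = x \<or> tgt \<Gamma> e = x) \<and>
    closed_edge \<Gamma> e \<subseteq> mcball (Vertex x) L}"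
  define \<Lambda> where "\<Lambda> = (\<Union>e\<in>S. closed_edge \<Gamma> e)"
  have S: "S \<subseteq> edges \<Gamma>" by (auto simp: S_def)
  have "is_subgraph \<Gamma> \<Lambda>" unfolding is_subgraph_def \<Lambda>_def
    by (intro exI[of _ "{}"] exI[of _ S]) (simp add: S)
  moreover have "closedin (graph_topology \<Gamma>) \<Lambda>"
    unfolding \<Lambda>_def by (rule closedin_union_closed_edges[OF S])
  moreover have "mbounded \<Lambda>"
    unfolding mbounded_def by (intro exI[of _ "Vertex x"] exI[of _ L]) (auto simp: \<Lambda>_def S_def)
  ultimately have compact: "compact_space (quotient_topology
      (subtopology (graph_topology \<Gamma>) (\<Union>g. act g ` \<Lambda>)) (\<lambda>p. range (\<lambda>g. act g p)))"
    using car unfolding coarse_CAR_graph_def bounded_cocompact_def by blast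
  have "\<Lambda> \<subseteq> points \<Gamma>" using closed_edge_subset S by (auto simp: \<Lambda>_def)
  then have GL: "(\<Union>g. act g ` \<Lambda>) \<subseteq> points \<Gamma>" using act_in_points by auto
  then have top: "topspace (subtopology (graph_topology \<Gamma>) (\<Union>g. act g ` \<Lambda>)) = (\<Union>g. act g ` \<Lambda>)"
    by auto
  define P where "P = (\<lambda>(n::nat) e. \<exists>a b. act a (Vertex x) = Vertex (src \<Gamma> e) \<and>
    act b (Vertex x) = Vertex (tgt \<Gamma> e) \<and> d a b < n)"
  \<comment> \<open>Any radius below \<open>r / 2\<close>, the least distance of a midpoint to a vertex, would do.\<close>
  define W where "W = (\<Union>v\<in>verts \<Gamma>. mball (Vertex v) (r / 4))"
  define I :: "nat \<Rightarrow> ('v, 'e) point set" where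
    "I = (\<lambda>n. {Inner e t | e t. e \<in> {e \<in> edges \<Gamma>. P n e} \<and> 0 < t \<and> t < len \<Gamma> e})"
  define U where "U = (\<lambda>n. (I n \<union> W) \<inter> (\<Union>g. act g ` \<Lambda>))"
  have W_inv: "act g p \<in> W" if p: "p \<in> W" for g p
  proof -
    obtain v where v: "v \<in> verts \<Gamma>" "p \<in> points \<Gamma>" "path_dist \<Gamma> (Vertex v) p < r / 4"
      using p by (auto simp: W_def)
    obtain w where w: "w \<in> verts \<Gamma>" "act g (Vertex v) = Vertex w" using act_vertex v by metis
    have "act g p \<in> mball (Vertex w) (r / 4)"
      using act_isometry[of "Vertex v" p g] v w act_in_points[of p g] by simp
    then show ?thesis using w by (auto simp: W_def)
  qed
  have I_inv: "act g p \<in> I n" if p: "p \<in> I n" for g p n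
  proof -
    obtain e t a b where e: "p = Inner e t" "e \<in> edges \<Gamma>" "0 < t" "t < len \<Gamma> e"
      and ab: "act a (Vertex x) = Vertex (src \<Gamma> e)" "act b (Vertex x) = Vertex (tgt \<Gamma> e)" "d a b < n"
      using p by (auto simp: I_def P_def)
    obtain e' s where e': "e' \<in> edges \<Gamma>" "0 < s" "s < len \<Gamma> e'" "act g p = Inner e' s"
      "{act g (Vertex (src \<Gamma> e)), act g (Vertex (tgt \<Gamma> e))} = {Vertex (src \<Gamma> e'), Vertex (tgt \<Gamma> e')}"
      using act_edge[OF e(2), of g] e by metis
    have "{act (g + a) (Vertex x), act (g + b) (Vertex x)} = {Vertex (src \<Gamma> e'), Vertex (tgt \<Gamma> e')}"
      using e'(5) ab act_add[of "Vertex x" g] x by simp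
    moreover have "d (g + a) (g + b) < n" "d (g + b) (g + a) < n"
      using ab(3) pseudometricD(5)[OF d] pseudometricD(3)[OF d] by metis+
    ultimately have "P n e'" unfolding P_def doubleton_eq_iff by blast
    then show ?thesis using e' by (auto simp: I_def)
  qed
  obtain n where n: "(\<Union>g. act g ` \<Lambda>) \<subseteq> U n"
  proof (rule compact_quotient_increasing_cover[OF compact, of U, unfolded top])
    show "openin (subtopology (graph_topology \<Gamma>) (\<Union>g. act g ` \<Lambda>)) (U n)" for n
      unfolding U_def I_def W_def
      by (intro openin_subtopology_Int openin_Un openin_union_open_edges openin_union_mball) auto
    have "P m e \<Longrightarrow> P n e" if "m \<le> n" for m n e
      unfolding P_def using that by (metis of_nat_mono order_less_le_trans)
    then show "U m \<subseteq> U n" if "m \<le> n" for m n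
      unfolding U_def I_def using that by blast
    show "(\<Union>g. act g ` \<Lambda>) \<subseteq> (\<Union>n. U n)"
    proof
      fix p assume p: "p \<in> (\<Union>g. act g ` \<Lambda>)"
      with GL have "p \<in> points \<Gamma>" by blast
      have "\<exists>n. p \<in> I n \<union> W"
      proof (cases p)
        case (Vertex v)
        then have "v \<in> verts \<Gamma>" "p \<in> mball (Vertex v) (r / 4)" using \<open>p \<in> points \<Gamma>\<close> r(1) by auto
        then show ?thesis by (auto simp: W_def)
      next
        case (Inner e t)
        then have e: "e \<in> edges \<Gamma>" "0 < t" "t < len \<Gamma> e"
          using \<open>p \<in> points \<Gamma>\<close> by (auto simp: inner_in_points)
        obtain a b where ab: "act a (Vertex x) = Vertex (src \<Gamma> e)" "act b (Vertex x) = Vertex (tgt \<Gamma> e)"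
          using transitive[OF x] wf_metric_graphD[OF wf e(1)] by metis
        obtain n :: nat where "d a b < n" using reals_Archimedean2 by blast
        then show ?thesis using ab e Inner by (auto simp: I_def P_def)
      qed
      then show "p \<in> (\<Union>n. U n)" using p by (auto simp: U_def)
    qed
    show "q \<in> U n"
      if p: "p \<in> U n" and q: "q \<in> (\<Union>g. act g ` \<Lambda>)"
        and orbit: "range (\<lambda>g. act g q) = range (\<lambda>g. act g p)"
      for n p q
    proof -
      have "act 0 q = q" using act_zero[OF subsetD[OF GL q]] .
      then have "q \<in> range (\<lambda>g. act g p)" unfolding orbit[symmetric] by (metis rangeI)
      then obtain g where "q = act g p" by blast
      then have "q \<in> I n \<union> W" using p W_inv[of p g] I_inv[of p n g] unfolding U_def by blast
      then show ?thesis using q unfolding U_def by blast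
    qed
  qed
  show ?thesis
  proof (rule that[of n])
    fix e assume e: "e \<in> edges \<Gamma>" "src \<Gamma> e \<noteq> tgt \<Gamma> e" "len \<Gamma> e \<le> L"
    note e' = wf_metric_graphD[OF wf e(1)]
    have "r \<le> len \<Gamma> e" by (rule r(2)[OF e(1,2)])
    obtain g where g: "act g (Vertex (src \<Gamma> e)) = Vertex x" using transitive[OF e'(1) x] by metis
    obtain a where a: "a \<in> edges \<Gamma>" "act g ` closed_edge \<Gamma> e = closed_edge \<Gamma> a"
      "{act g (Vertex (src \<Gamma> e)), act g (Vertex (tgt \<Gamma> e))} = {Vertex (src \<Gamma> a), Vertex (tgt \<Gamma> a)}"
      using act_edge[OF e(1), of g] by metis
    have "act g (Vertex (src \<Gamma> e)) \<noteq> act g (Vertex (tgt \<Gamma> e))"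
      using inj_onD[OF act_inj, of g "Vertex (src \<Gamma> e)" "Vertex (tgt \<Gamma> e)"] e e' by auto
    then have ends: "src \<Gamma> a \<noteq> tgt \<Gamma> a" "src \<Gamma> a = x \<or> tgt \<Gamma> a = x"
      using a(3) g by (auto simp: doubleton_eq_iff)
    have "closed_edge \<Gamma> a \<subseteq> mcball (Vertex x) L"
    proof
      fix q assume "q \<in> closed_edge \<Gamma> a"
      then have "q \<in> act g ` edge_point \<Gamma> e ` {0..len \<Gamma> e}"
        unfolding closed_edge_def by (simp only: a(2)[unfolded closed_edge_def])
      then obtain s where s: "s \<in> {0..len \<Gamma> e}" "q = act g (edge_point \<Gamma> e s)" by blast
      have "path_dist \<Gamma> (edge_point \<Gamma> e 0) (edge_point \<Gamma> e s) \<le> L"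
        using path_dist_edge_le[OF wf e(1), of 0 s] s(1) e(3) by auto
      then have "path_dist \<Gamma> (Vertex x) q \<le> L"
        using act_isometry[of "edge_point \<Gamma> e 0" "edge_point \<Gamma> e s" g] s(2) g e'
          edge_point_in_points[OF wf e(1)] by (simp add: edge_point_simps)
      then show "q \<in> mcball (Vertex x) L"
        using s(2) x act_in_points edge_point_in_points[OF wf e(1)] by auto
    qed
    then have "a \<in> S" using a(1) ends by (auto simp: S_def)
    define m where "m = (Inner e (len \<Gamma> e / 2) :: ('v, 'e) point)"
    have m: "m \<in> points \<Gamma>" "m \<in> closed_edge \<Gamma> e"
      using e(1) e'(3) unfolding m_def closed_edge_eq[OF e(1)]
      by (simp add: inner_in_points, intro UnI2 CollectI exI[of _ "len \<Gamma> e / 2"]) simp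
    have "act g m \<in> \<Lambda>" using m(2) a(2) \<open>a \<in> S\<close> by (auto simp: \<Lambda>_def)
    then have "act (- g) (act g m) \<in> (\<Union>g. act g ` \<Lambda>)" by blast
    then have "m \<in> U n" using n act_minus[OF m(1)] by auto
    moreover have "m \<notin> W"
    proof
      assume "m \<in> W"
      then obtain v where v: "v \<in> verts \<Gamma>" "path_dist \<Gamma> (Vertex v) m < r / 4" by (auto simp: W_def)
      with path_dist_midpoint_vertex[OF e(1) v(1)] \<open>r \<le> len \<Gamma> e\<close> r(1) show False
        by (simp add: m_def commute)
    qed
    ultimately have "m \<in> I n" by (auto simp: U_def)
    then show "\<exists>a b. act a (Vertex x) = Vertex (src \<Gamma> e) \<and> act b (Vertex x) = Vertex (tgt \<Gamma> e)
      \<and> d a b < n"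
      by (auto simp: I_def m_def P_def)
  qed
qed

text \<open>For a section \<open>\<sigma>\<close> of the orbit map, \<open>\<lambda>v. d (\<sigma> u) (\<sigma> v)\<close> is a potential on the vertices. Along an
  edge of length at most \<open>L\<close> it changes by at most \<open>n + 2 * M\<close>: the ends are reached by some two elements
  at distance less than \<open>n\<close>, and replacing each of them by the value of \<open>\<sigma>\<close> costs the diameter \<open>M\<close> of the
  stabilizer. Every edge that is not a loop has length at least \<open>r\<close>, which makes this a bounded rate of
  change.\<close>

lemma close_vertices_have_close_transporters:
  assumes d: "cont_left_invariant_pseudometric d" and x: "x \<in> verts \<Gamma>"
  obtains C where "\<And>a b. path_dist \<Gamma> (act a (Vertex x)) (act b (Vertex x)) < L \<Longrightarrow> d a b \<le> C"
proof -
  obtain r where r: "0 < r" "\<And>e. e \<in> edges \<Gamma> \<Longrightarrow> src \<Gamma> e \<noteq> tgt \<Gamma> e \<Longrightarrow> r \<le> len \<Gamma> e"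
    by (rule vertex_gap) blast
  obtain M where M: "0 < M" "\<And>a b. act a (Vertex x) = act b (Vertex x) \<Longrightarrow> d a b \<le> M"
    by (rule stabilizer_diameter[OF d x]) blast
  obtain n :: nat where n: "\<And>e. e \<in> edges \<Gamma> \<Longrightarrow> src \<Gamma> e \<noteq> tgt \<Gamma> e \<Longrightarrow> len \<Gamma> e \<le> L \<Longrightarrow>
       \<exists>a b. act a (Vertex x) = Vertex (src \<Gamma> e) \<and> act b (Vertex x) = Vertex (tgt \<Gamma> e) \<and> d a b < n"
    by (rule short_edges_uniformly_bounded[OF d x]) blast
  have "\<exists>g. act g (Vertex x) = Vertex v" if v: "v \<in> verts \<Gamma>" for v
    by (rule transitive[OF x v]) blast
  then obtain \<sigma> where \<sigma>: "\<And>v. v \<in> verts \<Gamma> \<Longrightarrow> act (\<sigma> v) (Vertex x) = Vertex v"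
    by metis
  define K where "K = (n + 2 * M) / r"
  have K: "0 < K" using M(1) r(1) by (simp add: K_def)
  show ?thesis
  proof (rule that[of "2 * M + K * L"])
    fix a b assume close: "path_dist \<Gamma> (act a (Vertex x)) (act b (Vertex x)) < L"
    obtain u where u: "u \<in> verts \<Gamma>" "act a (Vertex x) = Vertex u" using act_vertex x by metis
    obtain v where v: "v \<in> verts \<Gamma>" "act b (Vertex x) = Vertex v" using act_vertex x by metis
    obtain l where l: "pl_path \<Gamma> (Vertex u) l (Vertex v)" "l < L"
      using pl_path_shorter_than[OF path_exists[of "Vertex u" "Vertex v"]] close u v by auto
    have edge: "\<bar>d (\<sigma> u) (\<sigma> (src \<Gamma> e)) - d (\<sigma> u) (\<sigma> (tgt \<Gamma> e))\<bar> \<le> K * len \<Gamma> e"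
      if e: "e \<in> edges \<Gamma>" "len \<Gamma> e \<le> L" for e
    proof (cases "src \<Gamma> e = tgt \<Gamma> e")
      case True
      then show ?thesis using K wf_metric_graphD(3)[OF wf e(1)] by simp
    next
      case False
      note e' = wf_metric_graphD[OF wf e(1)]
      obtain a b where ab: "act a (Vertex x) = Vertex (src \<Gamma> e)" "act b (Vertex x) = Vertex (tgt \<Gamma> e)"
        "d a b < n"
        using n[OF e(1) False e(2)] by blast
      have "d (\<sigma> (src \<Gamma> e)) a \<le> M" "d b (\<sigma> (tgt \<Gamma> e)) \<le> M"
        using M(2) \<sigma> e' ab by auto
      then have "d (\<sigma> (src \<Gamma> e)) (\<sigma> (tgt \<Gamma> e)) \<le> n + 2 * M"
        using ab(3) pseudometricD(4)[OF d, of "\<sigma> (src \<Gamma> e)" "\<sigma> (tgt \<Gamma> e)" a]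
          pseudometricD(4)[OF d, of a "\<sigma> (tgt \<Gamma> e)" b] by linarith
      moreover have "\<bar>d (\<sigma> u) (\<sigma> (src \<Gamma> e)) - d (\<sigma> u) (\<sigma> (tgt \<Gamma> e))\<bar>
          \<le> d (\<sigma> (src \<Gamma> e)) (\<sigma> (tgt \<Gamma> e))"
        using pseudometricD(4)[OF d, of "\<sigma> u" "\<sigma> (src \<Gamma> e)" "\<sigma> (tgt \<Gamma> e)"]
          pseudometricD(4)[OF d, of "\<sigma> u" "\<sigma> (tgt \<Gamma> e)" "\<sigma> (src \<Gamma> e)"]
          pseudometricD(3)[OF d, of "\<sigma> (src \<Gamma> e)" "\<sigma> (tgt \<Gamma> e)"] by linarith
      moreover have "r \<le> len \<Gamma> e" by (rule r(2)[OF e(1) False])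
      then have "K * r \<le> K * len \<Gamma> e" using K by simp
      moreover have "K * r = n + 2 * M" using r(1) by (simp add: K_def)
      ultimately show ?thesis by linarith
    qed
    have "d (\<sigma> u) (\<sigma> v) \<le> K * l"
      using potential_le_path_length[OF l(1) less_imp_le[OF l(2)], of "\<lambda>w. d (\<sigma> u) (\<sigma> w)", OF _ K wf]
        edge pseudometricD(1,2)[OF d] by simp
    moreover have "K * l \<le> K * L" using K l(2) by simp
    moreover have "d a (\<sigma> u) \<le> M" "d (\<sigma> v) b \<le> M" using M(2) \<sigma> u v by auto
    ultimately show "d a b \<le> 2 * M + K * L"
      using pseudometricD(4)[OF d, of a b "\<sigma> u"] pseudometricD(4)[OF d, of "\<sigma> u" b "\<sigma> v"]
      by linarith
  qed
qed

lemma orbit_pseudometric: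
  assumes x: "x \<in> verts \<Gamma>"
  shows "cont_left_invariant_pseudometric (\<lambda>g h. path_dist \<Gamma> (act g (Vertex x)) (act h (Vertex x)))"
proof -
  define \<phi> where "\<phi> = (\<lambda>g. act g (Vertex x))"
  have \<phi>: "\<phi> g \<in> points \<Gamma>" for g using x act_in_points by (simp add: \<phi>_def)
  define f where "f = (\<lambda>z. path_dist \<Gamma> (\<phi> (fst z)) (\<phi> (snd z)))"
  have "continuous_on UNIV f"
    unfolding continuous_on_def
  proof (intro ballI, rule tendsto_eventually)
    fix z :: "'g \<times> 'g"
    define U where "U = {a. \<phi> a = \<phi> (fst z)} \<times> {b. \<phi> b = \<phi> (snd z)}"
    have "open U" unfolding U_def \<phi>_def by (intro open_Times open_vertex_transporter[OF x])
    moreover have "z \<in> U" by (simp add: U_def mem_Times_iff)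
    moreover have "f w = f z" if "w \<in> U" for w using that by (auto simp: U_def f_def)
    ultimately show "\<forall>\<^sub>F w in at z. f w = f z" unfolding eventually_at_topological by blast
  qed
  then have "continuous_on UNIV (\<lambda>(a, b). path_dist \<Gamma> (\<phi> a) (\<phi> b))"
    by (simp add: f_def split_beta)
  moreover have "path_dist \<Gamma> (\<phi> (g + a)) (\<phi> (g + b)) = path_dist \<Gamma> (\<phi> a) (\<phi> b)" for g a b
    using act_add[of "Vertex x" g] act_isometry[OF \<phi> \<phi>, of g a b] x by (simp add: \<phi>_def)
  moreover have "path_dist \<Gamma> (\<phi> a) (\<phi> a) = 0" for a using \<phi> by simp
  ultimately have "cont_left_invariant_pseudometric (\<lambda>g h. path_dist \<Gamma> (\<phi> g) (\<phi> h))"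
    unfolding cont_left_invariant_pseudometric_def pseudometric_def
    using triangle[OF \<phi> \<phi> \<phi>] commute nonneg by (intro conjI allI; blast)
  then show ?thesis by (simp add: \<phi>_def)
qed

text \<open>Any section of the orbit map is a coarse inverse: its composites with the orbit map move points
  only within cosets of the stabilizer, respectively not at all.\<close>

theorem orbit_map_coarse_equivalence:
  assumes x: "x \<in> verts \<Gamma>"
  shows "coarse_equivalence (UNIV :: 'g set) left_coarse
    (Vertex ` verts \<Gamma>) (metric_coarse (Vertex ` verts \<Gamma>) (path_dist \<Gamma>)) (\<lambda>g. act g (Vertex x))"
proof -
  let ?V = "Vertex ` verts \<Gamma>" and ?\<phi> = "\<lambda>g. act g (Vertex x)"
  have \<phi>: "?\<phi> g \<in> ?V" for g using act_vertex[OF x] by blast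
  have "\<exists>g. ?\<phi> g = p" if "p \<in> ?V" for p using that transitive[OF x] by (metis imageE)
  then obtain \<psi> where \<psi>: "\<And>p. p \<in> ?V \<Longrightarrow> ?\<phi> (\<psi> p) = p" by metis
  have "bornologous UNIV left_coarse ?V (metric_coarse ?V (path_dist \<Gamma>)) ?\<phi>"
    unfolding bornologous_def
  proof (intro conjI ballI)
    fix E :: "('g \<times> 'g) set" assume "E \<in> left_coarse"
    then obtain \<alpha> where "\<forall>(a, b)\<in>E. path_dist \<Gamma> (?\<phi> a) (?\<phi> b) < \<alpha>"
      using orbit_pseudometric[OF x] unfolding left_coarse_iff by blast
    then show "map_prod ?\<phi> ?\<phi> ` E \<in> metric_coarse ?V (path_dist \<Gamma>)"
      using \<phi> by (auto simp: metric_coarse_def intro!: exI[of _ \<alpha>])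
  qed (use \<phi> in blast)
  moreover have "bornologous ?V (metric_coarse ?V (path_dist \<Gamma>)) UNIV left_coarse \<psi>"
    unfolding bornologous_def
  proof (intro conjI ballI)
    fix E assume "E \<in> metric_coarse ?V (path_dist \<Gamma>)"
    then obtain L where E: "E \<subseteq> ?V \<times> ?V" "\<forall>(p, q)\<in>E. path_dist \<Gamma> p q < L"
      by (auto simp: metric_coarse_def)
    show "map_prod \<psi> \<psi> ` E \<in> left_coarse"
      unfolding left_coarse_iff
    proof (intro allI impI)
      fix d :: "'g \<Rightarrow> 'g \<Rightarrow> real" assume d: "cont_left_invariant_pseudometric d"
      obtain C where C: "\<And>a b. path_dist \<Gamma> (?\<phi> a) (?\<phi> b) < L \<Longrightarrow> d a b \<le> C"
        by (rule close_vertices_have_close_transporters[OF d x]) blast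
      have "d (\<psi> p) (\<psi> q) < C + 1" if "(p, q) \<in> E" for p q
      proof -
        have "?\<phi> (\<psi> p) = p" "?\<phi> (\<psi> q) = q" "path_dist \<Gamma> p q < L" using that E \<psi> by auto
        then show ?thesis using C[of "\<psi> p" "\<psi> q"] by simp
      qed
      then show "\<exists>\<alpha>. \<forall>(a, b)\<in>map_prod \<psi> \<psi> ` E. d a b < \<alpha>" by (intro exI[of _ "C + 1"]) auto
    qed
  qed auto
  moreover have "close_maps UNIV left_coarse (\<psi> \<circ> ?\<phi>) id"
  proof -
    have "range (\<lambda>g. (\<psi> (?\<phi> g), g)) \<in> left_coarse"
      unfolding left_coarse_iff
    proof (intro allI impI)
      fix d :: "'g \<Rightarrow> 'g \<Rightarrow> real" assume d: "cont_left_invariant_pseudometric d"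
      obtain M where "\<And>a b. ?\<phi> a = ?\<phi> b \<Longrightarrow> d a b \<le> M"
        using stabilizer_diameter[OF d x] by metis
      then have "d (\<psi> (?\<phi> g)) g < M + 1" for g using \<psi>[OF \<phi>] by (smt (verit))
      then show "\<exists>\<alpha>. \<forall>(a, b)\<in>range (\<lambda>g. (\<psi> (?\<phi> g), g)). d a b < \<alpha>"
        by (intro exI[of _ "M + 1"]) auto
    qed
    then show ?thesis unfolding close_maps_def by (rule bexI[rotated]) auto
  qed
  moreover have "close_maps ?V (metric_coarse ?V (path_dist \<Gamma>)) (?\<phi> \<circ> \<psi>) id"
    unfolding close_maps_def
  proof (rule bexI[of _ "Id_on ?V"])
    show "\<forall>p\<in>?V. ((?\<phi> \<circ> \<psi>) p, id p) \<in> Id_on ?V" using \<psi> by auto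
    have "path_dist \<Gamma> p p < 1" if "p \<in> ?V" for p using that by auto
    then show "Id_on ?V \<in> metric_coarse ?V (path_dist \<Gamma>)"
      by (auto simp: metric_coarse_def intro!: exI[of _ 1])
  qed
  ultimately show ?thesis unfolding coarse_equivalence_def by blast
qed

end


section \<open>Compact quotients and bounded edges\<close>

text \<open>The quotient is the continuous image of the compact set \<open>K\<close>.\<close>

lemma compact_quotient_of_compact_section:
  assumes "compactin X K" "q ` topspace X \<subseteq> q ` K"
  shows "compact_space (quotient_topology X q)"
proof -
  have "compactin (quotient_topology X q) (q ` K)"
    using assms(1) quotient_imp_continuous_map[OF quotient_map_quotient_topology]
    by (rule image_compactin)
  moreover have "q ` K = topspace (quotient_topology X q)"
    using assms(2) compactin_subset_topspace[OF assms(1)] by auto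
  ultimately show ?thesis by (simp add: compact_space_def)
qed

context metric_graph_space
begin

lemma compactin_closed_edge:
  assumes e: "e \<in> edges \<Gamma>"
  shows "compactin (graph_topology \<Gamma>) (closed_edge \<Gamma> e)"
proof -
  let ?I = "{0..len \<Gamma> e}"
  have "continuous_map (top_of_set ?I) (graph_topology \<Gamma>) (edge_point \<Gamma> e)"
    unfolding graph_topology_def continuous_map_to_metric
  proof (intro ballI allI impI)
    fix s and \<epsilon> :: real assume s: "s \<in> topspace (top_of_set ?I)" and "\<epsilon> > 0"
    have "edge_point \<Gamma> e t \<in> mball (edge_point \<Gamma> e s) \<epsilon>" if "t \<in> ?I \<inter> ball s \<epsilon>" for t
      using path_dist_edge_le[OF wf e, of s t] s that edge_point_in_points[OF wf e]
      by (auto simp: dist_real_def)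
    moreover have "openin (top_of_set ?I) (?I \<inter> ball s \<epsilon>)" by (simp add: openin_open_Int)
    moreover have "s \<in> ?I \<inter> ball s \<epsilon>" using s \<open>\<epsilon> > 0\<close> by simp
    ultimately show "\<exists>U. openin (top_of_set ?I) U \<and> s \<in> U \<and>
        (\<forall>t\<in>U. edge_point \<Gamma> e t \<in> mball (edge_point \<Gamma> e s) \<epsilon>)"
      by (intro exI[of _ "?I \<inter> ball s \<epsilon>"]) blast
  qed
  moreover have "compactin (top_of_set ?I) ?I" by (simp add: compactin_subtopology)
  ultimately show ?thesis
    unfolding closed_edge_def by (intro image_compactin)
qed

text \<open>The midpoint of an edge is at distance at least half its length from the ends.\<close>

lemma edge_length_le_of_mcball:
  assumes e: "e \<in> edges \<Gamma>" "closed_edge \<Gamma> e \<subseteq> mcball p B"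
  shows "len \<Gamma> e \<le> 4 * B"
proof -
  note e' = wf_metric_graphD[OF wf e(1)]
  have "Inner e (len \<Gamma> e / 2) \<in> closed_edge \<Gamma> e" "Vertex (src \<Gamma> e) \<in> closed_edge \<Gamma> e"
    using e'(3) unfolding closed_edge_eq[OF e(1)]
    by (intro UnI2 CollectI exI[of _ "len \<Gamma> e / 2"]) simp_all
  with e(2) have in_ball: "Inner e (len \<Gamma> e / 2) \<in> mcball p B" "Vertex (src \<Gamma> e) \<in> mcball p B"
    by blast+
  then have "path_dist \<Gamma> (Inner e (len \<Gamma> e / 2)) (Vertex (src \<Gamma> e)) \<le> B + B"
    using triangle[of "Inner e (len \<Gamma> e / 2)" p "Vertex (src \<Gamma> e)"] commute by auto
  with path_dist_midpoint_vertex[OF e(1) e'(1)] show ?thesis by simp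
qed

end


section \<open>The graph of cosets of an open subgroup\<close>

lemma image_eq_of_inverse:
  assumes "\<And>x. x \<in> A \<Longrightarrow> f x \<in> A" "\<And>x. x \<in> A \<Longrightarrow> g x \<in> A" "\<And>x. f (g x) = x"
  shows "f ` A = A"
  using assms by (metis image_subsetI subsetI subset_antisym image_eqI)

lemma range_right_translation: "range (\<lambda>h :: 'a::group_add. f (h + g)) = range f"
proof (intro equalityI subsetI)
  fix y assume "y \<in> range f"
  then obtain h where "y = f h" by blast
  then have "y = f ((h - g) + g)" by simp
  then show "y \<in> range (\<lambda>h. f (h + g))" by blast
qed blast

locale open_subgroup =
  fixes H :: "'g::{topological_group_add, polish_space} set"
  assumes subgroup: "is_subgroup H" and open_H: "open H"
begin

abbreviation tr :: "'g \<Rightarrow> 'g set \<Rightarrow> 'g set" where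
  "tr g \<equiv> (`) ((+) g)"

definition cosets :: "'g set set" where
  "cosets = range (\<lambda>g. tr g H)"

text \<open>The orbit of an edge under simultaneous translation of its ends. Orbits of pairs of cosets
  correspond to double cosets of \<open>H\<close>.\<close>

definition pair_orbit :: "'g set \<times> 'g set \<Rightarrow> ('g set \<times> 'g set) set" where
  "pair_orbit e = range (\<lambda>g. map_prod (tr g) (tr g) e)"

text \<open>The complete graph on the cosets, with a loop at each vertex and an edge for each ordered pair.
  The length of an edge is one more than the number of its orbit in an enumeration of all orbits. So the
  lengths are invariant and at least \<open>1\<close>, and edges of equal length are translates of each other.\<close>

definition coset_graph :: "('g set, 'g set \<times> 'g set) metric_graph" where
  "coset_graph = \<lparr>verts = cosets, edges = cosets \<times> cosets, src = fst, tgt = snd,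
     len = \<lambda>e. 1 + real (to_nat_on (pair_orbit ` (cosets \<times> cosets)) (pair_orbit e))\<rparr>"

definition coset_act ::
    "'g \<Rightarrow> ('g set, 'g set \<times> 'g set) point \<Rightarrow> ('g set, 'g set \<times> 'g set) point" where
  "coset_act g = map_point (tr g) (map_prod (tr g) (tr g))"

lemma coset_graph_simps [simp]:
  "verts coset_graph = cosets" "edges coset_graph = cosets \<times> cosets"
  "src coset_graph = fst" "tgt coset_graph = snd"
  by (simp_all add: coset_graph_def)

lemma tr_zero [simp]: "tr 0 A = A"
  by simp

lemma tr_add: "tr (g + h) A = tr g (tr h A)"
  by (simp add: image_image add.assoc)

lemma tr_coset: "A \<in> cosets \<Longrightarrow> tr g A \<in> cosets"
  unfolding cosets_def by (auto simp flip: tr_add)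

lemma tr_eq_self_iff: "tr h H = H \<longleftrightarrow> h \<in> H"
proof
  have H: "0 \<in> H" using subgroup by (simp add: is_subgroup_def)
  show "h \<in> H" if "tr h H = H" using imageI[OF H, of "(+) h"] that by simp
  assume h: "h \<in> H"
  have sub: "tr h' H \<subseteq> H" if "h' \<in> H" for h' using subgroup that by (auto simp: is_subgroup_def)
  have "- h \<in> H" using subgroup h by (simp add: is_subgroup_def)
  then have "tr h (tr (- h) H) \<subseteq> tr h H" by (intro image_mono sub)
  then have "H \<subseteq> tr h H" by (simp flip: tr_add)
  with sub[OF h] show "tr h H = H" by blast
qed

lemma tr_eq_tr_iff: "tr a H = tr b H \<longleftrightarrow> - a + b \<in> H"
proof -
  have "tr a H = tr b H \<longleftrightarrow> tr (- a) (tr a H) = tr (- a) (tr b H)"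
    by (metis tr_add add.right_inverse tr_zero)
  then show ?thesis by (simp add: tr_eq_self_iff flip: tr_add) (metis tr_eq_self_iff)
qed

lemma coset_stabilizer: "{g. tr g (tr a H) = tr a H} = {g. - a + g + a \<in> H}"
proof -
  have "tr g (tr a H) = tr a H \<longleftrightarrow> - a + (g + a) \<in> H" for g
    using tr_eq_tr_iff[of a "g + a"] by (auto simp: tr_add)
  then show ?thesis by (simp add: add.assoc)
qed

lemma open_coset_stabilizer:
  assumes "A \<in> cosets"
  shows "open {g. tr g A = A}"
proof -
  obtain a where a: "A = tr a H" using assms by (auto simp: cosets_def)
  have "open ((\<lambda>g. - a + g + a) -` H)"
    by (intro open_vimage open_H continuous_intros)
  then show ?thesis unfolding a coset_stabilizer by (simp add: vimage_def)
qed

text \<open>Disjoint nonempty open sets in a second countable space.\<close>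

lemma countable_cosets: "countable cosets"
proof (rule countable_disjoint_open_subsets)
  fix A assume "A \<in> cosets"
  then obtain a where a: "A = tr a H" by (auto simp: cosets_def)
  have "A = (\<lambda>g. - a + g) -` H"
    unfolding a by (auto simp: image_iff) (metis add.assoc add.left_neutral right_minus)
  then show "open A" by (auto intro!: open_vimage open_H continuous_intros)
next
  have tr_eq: "tr b H = tr x H" if "x \<in> tr b H" for x b
    using that tr_eq_tr_iff by (auto simp: add.assoc[symmetric])
  have "A = B" if "A \<in> cosets" "B \<in> cosets" "x \<in> A" "x \<in> B" for A B x
    using that tr_eq[of x] unfolding cosets_def by blast
  then show "disjoint cosets" unfolding pairwise_def disjnt_def by blast
qed

lemma len_coset_graph:
  "len coset_graph e = 1 + real (to_nat_on (pair_orbit ` (cosets \<times> cosets)) (pair_orbit e))"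
  by (simp add: coset_graph_def)

lemma pair_orbit_translate: "pair_orbit (map_prod (tr g) (tr g) e) = pair_orbit e"
proof -
  have "map_prod (tr h) (tr h) (map_prod (tr g) (tr g) e) = map_prod (tr (h + g)) (tr (h + g)) e" for h
    by (cases e) (simp add: tr_add)
  then show ?thesis
    using range_right_translation[of "\<lambda>k. map_prod (tr k) (tr k) e" g]
    by (simp only: pair_orbit_def)
qed

lemma len_translate: "len coset_graph (map_prod (tr g) (tr g) e) = len coset_graph e"
  by (simp add: len_coset_graph pair_orbit_translate)

lemma len_ge_1: "1 \<le> len coset_graph e"
  by (simp add: len_coset_graph)

lemma wf_coset_graph: "wf_metric_graph coset_graph"
  using less_le_trans[OF zero_less_one len_ge_1] by (auto simp: wf_metric_graph_def)

lemma coset_graph_path_to_vertex: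
  assumes "p \<in> points coset_graph"
  shows "\<exists>A\<in>cosets. \<exists>l. pl_path coset_graph p l (Vertex A)"
proof (cases p)
  case (Vertex A)
  then show ?thesis using assms pl_path_refl[OF assms] by (auto simp: points_def)
next
  case (Inner e t)
  then have e: "e \<in> edges coset_graph" "0 < t" "t < len coset_graph e"
    using assms by (auto simp: points_def)
  note e' = wf_metric_graphD[OF wf_coset_graph e(1)]
  have "pl_path coset_graph p \<bar>t - 0\<bar> (Vertex (src coset_graph e))"
    using pl_path_edge[OF wf_coset_graph e(1), of t 0] e e'(3) Inner by (simp add: edge_point_simps)
  then show ?thesis using e'(1) by auto
qed

lemma coset_graph_path_exists:
  assumes "p \<in> points coset_graph" "q \<in> points coset_graph"
  shows "\<exists>l. pl_path coset_graph p l q"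
proof -
  obtain A l where A: "A \<in> cosets" "pl_path coset_graph p l (Vertex A)"
    using coset_graph_path_to_vertex[OF assms(1)] by blast
  obtain B m where B: "B \<in> cosets" "pl_path coset_graph q m (Vertex B)"
    using coset_graph_path_to_vertex[OF assms(2)] by blast
  have e: "(A, B) \<in> edges coset_graph" using A B by simp
  have "0 < len coset_graph (A, B)" by (rule wf_metric_graphD[OF wf_coset_graph e])
  then have "pl_path coset_graph (Vertex A) (len coset_graph (A, B)) (Vertex B)"
    using pl_path_edge[OF wf_coset_graph e, of 0 "len coset_graph (A, B)"]
    by (simp add: edge_point_simps)
  from pl_path_trans[OF pl_path_trans[OF pl_path_sym[OF wf_coset_graph B(2)] this] A(2)]
  show ?thesis by blast
qed

lemma coset_graph_vertex_dist:
  assumes "A \<in> cosets" "B \<in> cosets" "A \<noteq> B"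
  shows "1 \<le> path_dist coset_graph (Vertex A) (Vertex B)"
proof (rule path_dist_isolated_vertex_ge[OF wf_coset_graph _ len_ge_1])
  show "\<exists>l. pl_path coset_graph (Vertex A) l (Vertex B)"
    using assms by (intro coset_graph_path_exists) (auto simp: points_def)
qed (use assms in auto)

lemma connected_coset_graph: "connected_metric_graph coset_graph"
proof -
  have inner: "0 < path_dist coset_graph (Inner e t) q"
    if p: "Inner e t \<in> points coset_graph" and q: "q \<in> points coset_graph" "q \<noteq> Inner e t" for e t q
  proof -
    define \<delta> where "\<delta> = min t (len coset_graph e - t)"
    have t: "0 < t" "t < len coset_graph e" using p by (auto simp: points_def)
    then have "0 < \<delta>" by (simp add: \<delta>_def)
    then have "bump e t \<delta> q < \<delta>"
      using q(2) by (auto simp: bump_def max_def split: point.splits)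
    moreover have "\<delta> - bump e t \<delta> q \<le> path_dist coset_graph (Inner e t) q"
      using \<open>0 < \<delta>\<close> coset_graph_path_exists[OF p q(1)]
      by (intro path_dist_inner_ge) (auto simp: \<delta>_def)
    ultimately show ?thesis by simp
  qed
  have "0 < path_dist coset_graph p q"
    if pq: "p \<in> points coset_graph" "q \<in> points coset_graph" "p \<noteq> q" for p q
  proof (cases p)
    case (Inner e t)
    then show ?thesis using inner[of e t q] pq by simp
  next
    case p: (Vertex A)
    show ?thesis
    proof (cases q)
      case (Vertex B)
      have "1 \<le> path_dist coset_graph p q"
        using coset_graph_vertex_dist[of A B] pq unfolding p Vertex by (auto simp: points_def)
      then show ?thesis by simp
    next
      case (Inner e t)
      then show ?thesis using inner[of e t p] pq path_dist_sym[OF wf_coset_graph, of p q] by simp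
    qed
  qed
  from path_dist_Metric_space[OF wf_coset_graph coset_graph_path_exists this]
  show ?thesis
    using wf_coset_graph coset_graph_path_exists
    by (auto simp: connected_metric_graph_def wf_metric_graph_def cosets_def)
qed

sublocale metric_graph_space coset_graph
  by unfold_locales (rule connected_coset_graph)

lemma coset_act_simps [simp]:
  "coset_act g (Vertex A) = Vertex (tr g A)"
  "coset_act g (Inner e t) = Inner (map_prod (tr g) (tr g) e) t"
  by (simp_all add: coset_act_def)

lemma coset_act_zero: "coset_act 0 p = p"
  by (cases p) (auto simp: prod.map_ident)

lemma coset_act_add: "coset_act (g + h) p = coset_act g (coset_act h p)"
proof -
  have "map_prod (tr (g + h)) (tr (g + h)) e = map_prod (tr g) (tr g) (map_prod (tr h) (tr h) e)" for e
    by (cases e) (simp add: tr_add)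
  then show ?thesis by (cases p) (simp_all add: tr_add)
qed

lemma coset_act_minus: "coset_act (- g) (coset_act g p) = p" "coset_act g (coset_act (- g) p) = p"
  by (simp_all flip: coset_act_add add: coset_act_zero)

lemma coset_act_orbit: "range (\<lambda>h. coset_act h (coset_act g p)) = range (\<lambda>h. coset_act h p)"
  using range_right_translation[of "\<lambda>h. coset_act h p" g] by (simp only: coset_act_add)

lemma coset_act_edge_point:
  "coset_act g (edge_point coset_graph e s) = edge_point coset_graph (map_prod (tr g) (tr g) e) s"
  by (auto simp: edge_point_def len_translate)

lemma translate_edge: "e \<in> edges coset_graph \<Longrightarrow> map_prod (tr g) (tr g) e \<in> edges coset_graph"
  by (auto simp: tr_coset)

lemma coset_act_closed_edge:
  "coset_act g ` closed_edge coset_graph e = closed_edge coset_graph (map_prod (tr g) (tr g) e)"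
  by (simp add: closed_edge_def image_image coset_act_edge_point len_translate)

lemma coset_act_in_points:
  assumes "p \<in> points coset_graph"
  shows "coset_act g p \<in> points coset_graph"
proof (cases p)
  case (Vertex A)
  then show ?thesis using assms by (simp add: tr_coset)
next
  case (Inner e t)
  then have "e \<in> edges coset_graph" "0 < t" "t < len coset_graph e"
    using assms by (simp_all add: inner_in_points)
  with translate_edge[of e g] show ?thesis
    by (simp only: Inner coset_act_simps inner_in_points len_translate simp_thms)
qed

lemma coset_act_path: "pl_path coset_graph p l q \<Longrightarrow> pl_path coset_graph (coset_act g p) l (coset_act g q)"
proof (induction rule: pl_path.induct)
  case (pl_path_step p l e s t)
  then show ?case
    using pl_path.pl_path_step[OF pl_path_step.IH[unfolded coset_act_edge_point] translate_edge]
    by (simp add: coset_act_edge_point len_translate)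
qed (rule pl_path_refl[OF coset_act_in_points])

lemma coset_act_isometry:
  "path_dist coset_graph (coset_act g p) (coset_act g q) = path_dist coset_graph p q"
proof -
  have "pl_path coset_graph (coset_act g p) l (coset_act g q) \<longleftrightarrow> pl_path coset_graph p l q" for l
    using coset_act_path[of p l q g] coset_act_path[of "coset_act g p" l "coset_act g q" "- g"]
    by (auto simp: coset_act_minus)
  then show ?thesis by (simp add: path_dist_def)
qed

lemma coset_act_automorphism: "graph_automorphism coset_graph (coset_act g)"
  unfolding graph_automorphism_def
proof (intro conjI)
  show "bij_betw (coset_act g) (points coset_graph) (points coset_graph)"
    by (rule bij_betwI[where g = "coset_act (- g)"])
      (auto simp: coset_act_in_points coset_act_minus)
  show "coset_act g ` Vertex ` verts coset_graph = Vertex ` verts coset_graph"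
    by (rule image_eq_of_inverse[where g = "coset_act (- g)"])
      (auto simp: tr_coset coset_act_minus)
  have "map_prod (tr g) (tr g) ` edges coset_graph = edges coset_graph"
    by (rule image_eq_of_inverse[where g = "map_prod (tr (- g)) (tr (- g))"])
      (auto simp: tr_coset simp flip: tr_add)
  then have "closed_edge coset_graph ` map_prod (tr g) (tr g) ` edges coset_graph
      = closed_edge coset_graph ` edges coset_graph"
    by simp
  then show "(\<lambda>e. coset_act g ` closed_edge coset_graph e) ` edges coset_graph
      = closed_edge coset_graph ` edges coset_graph"
    by (simp only: coset_act_closed_edge image_image)
qed

lemma open_point_stabilizer:
  assumes "p \<in> points coset_graph"
  shows "\<exists>U. open U \<and> 0 \<in> U \<and> (\<forall>g\<in>U. coset_act g p = p)"
proof (cases p)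
  case (Vertex A)
  then show ?thesis using assms open_coset_stabilizer[of A]
    by (intro exI[of _ "{g. tr g A = A}"]) auto
next
  case (Inner e t)
  obtain A B where e: "e = (A, B)" by (cases e)
  have "open ({g. tr g A = A} \<inter> {g. tr g B = B})"
    using assms Inner e by (intro open_Int open_coset_stabilizer) (auto simp: points_def)
  then show ?thesis
    using Inner e by (intro exI[of _ "{g. tr g A = A} \<inter> {g. tr g B = B}"]) auto
qed

text \<open>For an action by isometries, joint continuity follows from the openness of the stabilizers of
  points: if \<open>h\<close> and \<open>g\<close> move \<open>p\<close> to the same point, then \<open>h q\<close> is as close to \<open>g p\<close> as \<open>q\<close> is to \<open>p\<close>.\<close>

lemma coset_act_continuous:
  "continuous_map (prod_topology euclidean (graph_topology coset_graph))
     (graph_topology coset_graph) (\<lambda>(g, p). coset_act g p)"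
  unfolding graph_topology_def continuous_map_to_metric
proof (intro ballI allI impI)
  fix z and \<epsilon> :: real
  assume z: "z \<in> topspace (prod_topology (euclidean :: 'g topology) mtopology)" and "\<epsilon> > 0"
  obtain g p where gp: "z = (g, p)" "p \<in> points coset_graph" using z by auto
  obtain U where U: "open U" "0 \<in> U" "\<forall>g\<in>U. coset_act g p = p"
    using open_point_stabilizer[OF gp(2)] by blast
  define W where "W = ((\<lambda>h. - g + h) -` U) \<times> mball p \<epsilon>"
  have "open ((\<lambda>h. - g + h) -` U)" by (intro open_vimage U continuous_intros)
  then have "openin (prod_topology euclidean mtopology) W"
    by (auto simp: W_def openin_prod_Times_iff)
  moreover have "z \<in> W" using U gp \<open>\<epsilon> > 0\<close> by (simp add: W_def)
  moreover have "(case w of (h, q) \<Rightarrow> coset_act h q) \<in>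
      mball (case z of (h, q) \<Rightarrow> coset_act h q) \<epsilon>" if "w \<in> W" for w
  proof -
    obtain h q where w: "w = (h, q)" "- g + h \<in> U" "q \<in> points coset_graph" "path_dist coset_graph p q < \<epsilon>"
      using \<open>w \<in> W\<close> by (cases w) (auto simp: W_def)
    have "coset_act g p = coset_act g (coset_act (- g + h) p)" using U(3) w(2) by simp
    also have "\<dots> = coset_act h p" by (simp flip: coset_act_add)
    finally have "path_dist coset_graph (coset_act g p) (coset_act h q) < \<epsilon>"
      using w(4) by (simp add: coset_act_isometry)
    then show ?thesis using gp w by (simp add: coset_act_in_points)
  qed
  ultimately show "\<exists>W. openin (prod_topology euclidean mtopology) W \<and> z \<in> W \<and>
      (\<forall>w\<in>W. (case w of (h, q) \<Rightarrow> coset_act h q) \<in> mball (case z of (h, q) \<Rightarrow> coset_act h q) \<epsilon>)"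
    by blast
qed

lemma coset_vertices_discrete:
  "subtopology (graph_topology coset_graph) (Vertex ` cosets) = discrete_topology (Vertex ` cosets)"
proof -
  let ?X = "subtopology (graph_topology coset_graph) (Vertex ` cosets)"
  have "openin ?X {Vertex A}" if A: "A \<in> cosets" for A
  proof -
    have "{Vertex A} = mball (Vertex A) 1 \<inter> Vertex ` cosets"
    proof
      show "{Vertex A} \<subseteq> mball (Vertex A) 1 \<inter> Vertex ` cosets" using A by simp
      show "mball (Vertex A) 1 \<inter> Vertex ` cosets \<subseteq> {Vertex A}"
      proof
        fix p assume "p \<in> mball (Vertex A) 1 \<inter> Vertex ` cosets"
        then obtain B where B: "p = Vertex B" "B \<in> cosets" "path_dist coset_graph (Vertex A) p < 1"
          by auto
        with coset_graph_vertex_dist[OF A B(2)] have "A = B" by force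
        with B(1) show "p \<in> {Vertex A}" by simp
      qed
    qed
    moreover have "openin (graph_topology coset_graph) (mball (Vertex A) 1)"
      by (simp add: graph_topology_def)
    ultimately show ?thesis unfolding openin_subtopology by blast
  qed
  moreover have "topspace ?X = Vertex ` cosets" by (auto simp: points_def)
  ultimately show ?thesis using discrete_topology_unique[of "Vertex ` cosets" ?X] by auto
qed

lemma coset_act_transitive:
  assumes "A \<in> cosets" "B \<in> cosets"
  shows "\<exists>g. coset_act g (Vertex A) = Vertex B"
proof -
  obtain a b where "A = tr a H" "B = tr b H" using assms by (auto simp: cosets_def)
  then have "tr (b - a) A = B" by (simp flip: tr_add)
  then show ?thesis by auto
qed

text \<open>There are only finitely many lengths up to \<open>L\<close>, and each is the length of a single orbit.\<close>

lemma finitely_many_short_edge_orbits: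
  assumes "E \<subseteq> edges coset_graph" "\<And>e. e \<in> E \<Longrightarrow> len coset_graph e \<le> L"
  obtains F where "finite F" "F \<subseteq> E" "\<And>e. e \<in> E \<Longrightarrow> \<exists>f\<in>F. \<exists>g. e = map_prod (tr g) (tr g) f"
proof -
  let ?O = "pair_orbit ` (cosets \<times> cosets)"
  have "to_nat_on ?O ` pair_orbit ` E \<subseteq> {..nat \<lfloor>L\<rfloor>}"
    using assms(2) by (force simp: len_coset_graph le_nat_floor)
  then have "finite (to_nat_on ?O ` pair_orbit ` E)" by (rule finite_subset) simp
  moreover have "inj_on (to_nat_on ?O) (pair_orbit ` E)"
    by (rule inj_on_subset[OF inj_on_to_nat_on]) (use countable_cosets assms(1) in auto)
  ultimately have "finite (pair_orbit ` E)" by (rule finite_imageD)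
  from finite_subset_image[OF this subset_refl]
  obtain F where F: "F \<subseteq> E" "finite F" "pair_orbit ` E = pair_orbit ` F" by blast
  have "\<exists>f\<in>F. \<exists>g. e = map_prod (tr g) (tr g) f" if e: "e \<in> E" for e
  proof -
    obtain f where f: "f \<in> F" "pair_orbit e = pair_orbit f" using F(3) e by blast
    have "map_prod (tr 0) (tr 0) e \<in> pair_orbit e" unfolding pair_orbit_def by (rule rangeI)
    then have "e \<in> pair_orbit f" using f(2) by (cases e) simp
    then show ?thesis using f(1) unfolding pair_orbit_def by blast
  qed
  with F show ?thesis using that by blast
qed

text \<open>A bounded subgraph has edges of bounded length only, hence finitely many orbits of edges. One closed
  edge from each of them, and a vertex if there is any, form a compact set that meets all orbits.\<close>

lemma coset_act_bounded_cocompact: "bounded_cocompact coset_graph coset_act"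
  unfolding bounded_cocompact_def
proof (intro allI impI)
  fix \<Lambda>
  assume *: "is_subgraph coset_graph \<Lambda> \<and> closedin (graph_topology coset_graph) \<Lambda> \<and> mbounded \<Lambda>"
  then obtain V E where VE: "V \<subseteq> cosets" "E \<subseteq> edges coset_graph"
    "\<Lambda> = Vertex ` V \<union> (\<Union>e\<in>E. closed_edge coset_graph e)"
    by (auto simp: is_subgraph_def)
  obtain x B where B: "\<Lambda> \<subseteq> mcball x B" using * by (auto simp: mbounded_def)
  have short: "len coset_graph e \<le> 4 * B" if "e \<in> E" for e
    using edge_length_le_of_mcball[of e x B] that VE B by blast
  obtain F where F: "finite F" "F \<subseteq> E" "\<And>e. e \<in> E \<Longrightarrow> \<exists>f\<in>F. \<exists>g. e = map_prod (tr g) (tr g) f"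
    by (rule finitely_many_short_edge_orbits[OF VE(2)]; blast intro: short)
  obtain V0 where V0: "finite V0" "V0 \<subseteq> V" "\<And>A. A \<in> V \<Longrightarrow> \<exists>B\<in>V0. \<exists>g. coset_act g (Vertex B) = Vertex A"
  proof (cases "V = {}")
    case False
    then obtain B where "B \<in> V" by blast
    then show ?thesis using that[of "{B}"] coset_act_transitive VE(1) by blast
  qed (use that[of "{}"] in auto)
  define K where "K = Vertex ` V0 \<union> (\<Union>f\<in>F. closed_edge coset_graph f)"
  let ?G\<Lambda> = "\<Union>g. coset_act g ` \<Lambda>" and ?q = "\<lambda>p. range (\<lambda>g. coset_act g p)"
  let ?X = "subtopology (graph_topology coset_graph) ?G\<Lambda>"
  have "K \<subseteq> \<Lambda>" using F V0 VE by (auto simp: K_def)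
  moreover have "\<Lambda> \<subseteq> ?G\<Lambda>"
  proof
    fix p assume "p \<in> \<Lambda>"
    then have "coset_act 0 p \<in> ?G\<Lambda>" by blast
    then show "p \<in> ?G\<Lambda>" by (simp add: coset_act_zero)
  qed
  ultimately have "K \<subseteq> ?G\<Lambda>" by blast
  moreover have "compactin (graph_topology coset_graph) K"
    unfolding K_def
  proof (intro compactin_Un compactin_Union)
    show "compactin (graph_topology coset_graph) (Vertex ` V0)"
      using V0 VE(1) by (intro finite_imp_compactin) auto
  qed (use F VE compactin_closed_edge in auto)
  ultimately have "compactin ?X K" by (simp add: compactin_subtopology)
  moreover have "?q ` topspace ?X \<subseteq> ?q ` K"
  proof
    fix y assume "y \<in> ?q ` topspace ?X"
    then obtain g p where p: "p \<in> \<Lambda>" "y = ?q (coset_act g p)" by auto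
    then have y: "y = ?q p" by (simp add: coset_act_orbit)
    have "\<exists>k\<in>K. \<exists>h. p = coset_act h k"
    proof (cases "p \<in> Vertex ` V")
      case True
      then obtain A where A: "A \<in> V" "p = Vertex A" by blast
      then show ?thesis using V0(3)[OF A(1)] by (force simp: K_def)
    next
      case False
      then obtain e s where e: "e \<in> E" "p = edge_point coset_graph e s" "s \<in> {0..len coset_graph e}"
        using p(1) VE(3) by (auto simp: closed_edge_def)
      obtain f h where f: "f \<in> F" "e = map_prod (tr h) (tr h) f" using F(3)[OF e(1)] by blast
      have "p = coset_act h (edge_point coset_graph f s)" by (simp add: coset_act_edge_point e f)
      moreover have "edge_point coset_graph f s \<in> closed_edge coset_graph f"
        using e(3) f(2) len_translate[of h f] unfolding closed_edge_def by (intro imageI) simp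
      then have "edge_point coset_graph f s \<in> K" using f(1) unfolding K_def by blast
      ultimately show ?thesis by blast
    qed
    then obtain k h where "k \<in> K" "p = coset_act h k" by blast
    then show "y \<in> ?q ` K" using y by (simp add: coset_act_orbit)
  qed
  ultimately show "compact_space (quotient_topology ?X ?q)"
    by (rule compact_quotient_of_compact_section)
qed

text \<open>The stabilizer of \<open>a + H\<close> is the conjugate of \<open>H\<close> by \<open>a\<close>. Right translation by \<open>a\<close> moves every element by
  the distance \<open>d 0 a\<close>, whence the constant \<open>2 * d 0 a\<close>.\<close>

lemma coset_stabilizer_bounded:
  assumes H: "coarsely_bounded H" and A: "A \<in> cosets"
  shows "coarsely_bounded {g. tr g A = A}"
  unfolding coarsely_bounded_iff
proof (intro allI impI)
  obtain a where a: "A = tr a H" using A by (auto simp: cosets_def)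
  fix d :: "'g \<Rightarrow> 'g \<Rightarrow> real" assume d: "cont_left_invariant_pseudometric d"
  obtain M where M: "\<And>h k. h \<in> H \<Longrightarrow> k \<in> H \<Longrightarrow> d h k < M"
    using H d unfolding coarsely_bounded_iff by blast
  have "d g k < M + 2 * d 0 a" if "- a + g + a \<in> H" "- a + k + a \<in> H" for g k
  proof -
    have inv: "d (- a + x) (- a + y) = d x y" "d x (x + a) = d 0 a" for x y
      using pseudometricD(5)[OF d, of "- a" x y] pseudometricD(5)[OF d, of x 0 a] by simp_all
    have "d (g + a) (k + a) < M" using M[OF that] inv(1)[of "g + a" "k + a"] by (simp add: add.assoc)
    moreover have "d (k + a) k = d 0 a" using pseudometricD(3)[OF d] inv(2) by simp
    ultimately show ?thesis
      using pseudometricD(4)[OF d, of g k "g + a"] pseudometricD(4)[OF d, of "g + a" k "k + a"] inv(2)[of g]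
      by linarith
  qed
  then show "\<exists>\<alpha>. \<forall>g\<in>{g. tr g A = A}. \<forall>k\<in>{g. tr g A = A}. d g k < \<alpha>"
    unfolding a coset_stabilizer by blast
qed

theorem coset_graph_is_CAR:
  assumes "coarsely_bounded H"
  shows "coarse_CAR_graph coset_graph coset_act"
  using connected_coset_graph coset_vertices_discrete coset_act_transitive
    coset_act_bounded_cocompact coset_stabilizer_bounded[OF assms]
  by (auto simp: coarse_CAR_graph_def continuous_isometric_graph_action_def coset_act_zero
      coset_act_add coset_act_automorphism coset_act_isometry coset_act_continuous)

end

theorem proposition4p3:
  shows
    "(\<forall>(\<Gamma> :: ('v, 'e) metric_graph)
       (act :: 'g::{topological_group_add, polish_space} \<Rightarrow> ('v, 'e) point \<Rightarrow> ('v, 'e) point).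
        coarse_CAR_graph \<Gamma> act \<longrightarrow>
          locally_bounded TYPE('g) \<and>
          (\<forall>x\<in>verts \<Gamma>.
             coarse_equivalence (UNIV :: 'g set) left_coarse
               (Vertex ` verts \<Gamma>) (metric_coarse (Vertex ` verts \<Gamma>) (path_dist \<Gamma>))
               (\<lambda>g. act g (Vertex x)))) \<and>
     (non_archimedean TYPE('g) \<longrightarrow> locally_bounded TYPE('g) \<longrightarrow>
        (\<exists>(\<Gamma> :: ('g set, 'g set \<times> 'g set) metric_graph)
          (act :: 'g \<Rightarrow> ('g set, 'g set \<times> 'g set) point \<Rightarrow> ('g set, 'g set \<times> 'g set) point).
           coarse_CAR_graph \<Gamma> act))"
proof (intro conjI allI impI ballI)
  fix \<Gamma> :: "('v, 'e) metric_graph" and act :: "'g \<Rightarrow> ('v, 'e) point \<Rightarrow> ('v, 'e) point"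
  assume "coarse_CAR_graph \<Gamma> act"
  then interpret CAR_graph \<Gamma> act by unfold_locales
  show "locally_bounded TYPE('g)" by (rule locally_bounded)
  show "coarse_equivalence (UNIV :: 'g set) left_coarse
      (Vertex ` verts \<Gamma>) (metric_coarse (Vertex ` verts \<Gamma>) (path_dist \<Gamma>)) (\<lambda>g. act g (Vertex x))"
    if "x \<in> verts \<Gamma>" for x
    using that by (rule orbit_map_coarse_equivalence)
next
  assume na: "non_archimedean TYPE('g)" and "locally_bounded TYPE('g)"
  then obtain U :: "'g set" where U: "0 \<in> interior U" "coarsely_bounded U"
    by (auto simp: locally_bounded_def)
  obtain H where H: "is_subgroup H" "open H" "H \<subseteq> interior U"
    using na U(1) open_interior[of U] unfolding non_archimedean_def by blast
  interpret open_subgroup H by unfold_locales (fact H)+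
  have "coarsely_bounded H"
    using U(2) H(3) interior_subset by (blast intro: coarsely_bounded_subset)
  then show "\<exists>(\<Gamma> :: ('g set, 'g set \<times> 'g set) metric_graph)
      (act :: 'g \<Rightarrow> ('g set, 'g set \<times> 'g set) point \<Rightarrow> ('g set, 'g set \<times> 'g set) point).
      coarse_CAR_graph \<Gamma> act"
    using coset_graph_is_CAR by blast
qed

end
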